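(* Let $M$ be a $\xi$-vertical $CR$-submanifold of an $LP$-Sasakian manifold $(M',\phi,\xi,\eta,g)$ with a generalized symmetric metric connection $\overline{\nabla}$ of type $(\alpha,\beta)$. Then the distribution $D^{\bot}$ is integrable if and only if $$A_{\phi Y}Z-A_{\phi Z}Y=(\beta-1)\{\eta(Y)Z-\eta(Z)Y\}$$ for any $Y,Z\in\Gamma(D^{\bot})$.
   Context: An $LP$-Sasakian manifold $(M',\phi,\xi,\eta,g)$ is a differentiable manifold with a $(1,1)$ tensor field $\phi$, a vector field $\xi$, a $1$-form $\eta$ and a Lorentzian metric $g$ with Levi-Civita connection $\nabla$ such that, for all vector fields $U,V$: $\eta(\xi)=-1$, $\phi^2U=U+\eta(U)\xi$, $g(\phi U,\phi V)=g(U,V)+\eta(U)\eta(V)$, $g(U,\xi)=\eta(U)$, $\nabla_U\xi=\phi U$, $(\nabla_U\phi)(V)=g(U,V)\xi+\eta(V)U+2\eta(U)\eta(V)\xi$. The generalized symmetric metric connection of type $(\alpha,\beta)$ on $M'$ ($\alpha,\beta$ smooth functions) is $\overline{\nabla}_UV=\nabla_UV+\alpha\{\eta(V)U-g(U,V)\xi\}+\beta\{\eta(V)\phi U-g(\phi U,V)\xi\}$. A submanifold $M$ of $M'$ (with induced metric) is a $CR$-submanifold if $\xi$ is tangent to $M$ and there is a differentiable distribution $D$ on $M$ with $\phi D\subset D$ whose orthogonal complementary distribution $D^{\bot}$ in $TM$ satisfies $\phi D^{\bot}\subset T^{\bot}M$ (so $TM=D\oplus D^{\bot}$). It is $\xi$-vertical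 if $\xi\in\Gamma(D^{\bot})$. For $N\in\Gamma(T^{\bot}M)$ and $X\in\Gamma(TM)$, the shape operator $A_N$ is defined by the Weingarten formula of the Levi-Civita connection, $\nabla_XN=-A_NX+\nabla_X^{\bot}N$, with $A_NX$ tangent to $M$ and $\nabla_X^{\bot}N$ normal. *)

theory Defs
  imports "HOL-Analysis.Analysis" "HOL-Library.Function_Algebras"
begin

text \<open>The pointwise vector space structure on functions; tangent vectors below are
  elements of such a space.\<close>

instantiation "fun" :: (type, real_vector) real_vector
begin

definition scaleR_fun :: "real \<Rightarrow> ('a \<Rightarrow> 'b) \<Rightarrow> 'a \<Rightarrow> 'b"
  where "scaleR_fun r f = (\<lambda>x. r *\<^sub>R f x)"

instance
  by standard (auto simp: scaleR_fun_def fun_eq_iff scaleR_add_right scaleR_add_left)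

end

lemma scaleR_fun_apply [simp]: "(r *\<^sub>R f) x = r *\<^sub>R f x"
  by (simp add: scaleR_fun_def)

section \<open>Smooth manifolds\<close>

text \<open>Both predicates are meant for open \<open>S\<close> only.\<close>

primrec Ck_on :: "nat \<Rightarrow> 'a::euclidean_space set \<Rightarrow> ('a \<Rightarrow> 'b::real_normed_vector) \<Rightarrow> bool" where
  "Ck_on 0 S f \<longleftrightarrow> continuous_on S f"
| "Ck_on (Suc k) S f \<longleftrightarrow>
     f differentiable_on S \<and> (\<forall>v. Ck_on k S (\<lambda>x. frechet_derivative f (at x) v))"

definition smooth_on :: "'a::euclidean_space set \<Rightarrow> ('a \<Rightarrow> 'b::real_normed_vector) \<Rightarrow> bool"
  where "smooth_on S f \<longleftrightarrow> (\<forall>k. Ck_on k S f)"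

text \<open>A chart is a pair of its domain and its coordinate map.  The manifold is the whole type
  \<open>'p\<close>, the Hausdorff and second countability axioms being carried by its type classes.\<close>

type_synonym ('p, 'e) chart = "'p set \<times> ('p \<Rightarrow> 'e)"

definition chart_inv :: "('p, 'e) chart \<Rightarrow> 'e \<Rightarrow> 'p"
  where "chart_inv C = inv_into (fst C) (snd C)"

definition smooth_atlas ::
    "('p::{t2_space,second_countable_topology}, 'e::euclidean_space) chart set \<Rightarrow> bool"
  where "smooth_atlas A \<longleftrightarrow>
    (\<Union>C\<in>A. fst C) = UNIV \<and>
    (\<forall>C\<in>A. open (fst C) \<and> open (snd C ` fst C) \<and>
       homeomorphism (fst C) (snd C ` fst C) (snd C) (chart_inv C)) \<and>
    (\<forall>C\<in>A. \<forall>C'\<in>A. smooth_on (snd C ` (fst C \<inter> fst C')) (snd C' \<circ> chart_inv C))"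

text \<open>\<open>f\<close> is smooth on some neighbourhood of \<open>p\<close>, i.e. it represents a germ of smooth functions.\<close>

definition smooth_at ::
    "('p::topological_space, 'e::euclidean_space) chart set \<Rightarrow> 'p \<Rightarrow> ('p \<Rightarrow> real) \<Rightarrow> bool"
  where "smooth_at A p f \<longleftrightarrow>
    (\<exists>W. open W \<and> p \<in> W \<and> (\<forall>C\<in>A. smooth_on (snd C ` (fst C \<inter> W)) (f \<circ> chart_inv C)))"

definition smooth_fun ::
    "('p::topological_space, 'e::euclidean_space) chart set \<Rightarrow> ('p \<Rightarrow> real) \<Rightarrow> bool"
  where "smooth_fun A f \<longleftrightarrow> (\<forall>p. smooth_at A p f)"

section \<open>Tangent vectors and vector fields\<close>

text \<open>Tangent vectors at \<open>p\<close> are the derivations \<open>f \<mapsto> \<partial>\<^sub>u (f \<circ> c\<inverse>) (c p)\<close> on functions smooth near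
  \<open>p\<close>.  They are made total by the value \<open>0\<close> on all other functions, so that equality of tangent
  vectors is equality of HOL functions.\<close>

type_synonym 'p tvec = "('p \<Rightarrow> real) \<Rightarrow> real"

definition coord_vec ::
    "('p::topological_space, 'e::euclidean_space) chart set \<Rightarrow> ('p, 'e) chart \<Rightarrow> 'p \<Rightarrow> 'e \<Rightarrow> 'p tvec"
  where "coord_vec A C p u =
    (\<lambda>f. if smooth_at A p f then frechet_derivative (f \<circ> chart_inv C) (at (snd C p)) u else 0)"

definition tangent_space ::
    "('p::topological_space, 'e::euclidean_space) chart set \<Rightarrow> 'p \<Rightarrow> 'p tvec set"
  where "tangent_space A p = {coord_vec A C p u | C u. C \<in> A \<and> p \<in> fst C}"

definition smooth_map_at ::
    "('q::t2_space, 'm::euclidean_space) chart set \<Rightarrow>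
     ('p::topological_space, 'n::euclidean_space) chart set \<Rightarrow> ('q \<Rightarrow> 'p) \<Rightarrow> 'q \<Rightarrow> bool"
  where "smooth_map_at B A i q \<longleftrightarrow>
    isCont i q \<and> (\<forall>f. smooth_at A (i q) f \<longrightarrow> smooth_at B q (f \<circ> i))"

text \<open>The differential of \<open>i\<close> at \<open>q\<close>; only the atlas of the target is needed.\<close>

definition pushforward ::
    "('p::topological_space, 'n::euclidean_space) chart set \<Rightarrow> ('q \<Rightarrow> 'p) \<Rightarrow> 'q \<Rightarrow>
     'q tvec \<Rightarrow> 'p tvec"
  where "pushforward A i q v = (\<lambda>f. if smooth_at A (i q) f then v (f \<circ> i) else 0)"

definition immersion ::
    "('q::t2_space, 'm::euclidean_space) chart set \<Rightarrow>
     ('p::topological_space, 'n::euclidean_space) chart set \<Rightarrow> ('q \<Rightarrow> 'p) \<Rightarrow> bool"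
  where "immersion B A i \<longleftrightarrow>
    (\<forall>q. smooth_map_at B A i q \<and> inj_on (pushforward A i q) (tangent_space B q))"

text \<open>\<open>V\<close> is, on a neighbourhood of \<open>q\<close>, a smooth vector field along the map \<open>i\<close>.\<close>

definition smooth_field_along_at ::
    "('q::topological_space, 'm::euclidean_space) chart set \<Rightarrow>
     ('p::topological_space, 'n::euclidean_space) chart set \<Rightarrow> ('q \<Rightarrow> 'p) \<Rightarrow> 'q \<Rightarrow>
     ('q \<Rightarrow> 'p tvec) \<Rightarrow> bool"
  where "smooth_field_along_at B A i q V \<longleftrightarrow>
    (\<forall>\<^sub>F y in nhds q. V y \<in> tangent_space A (i y)) \<and>
    (\<forall>f. smooth_at A (i q) f \<longrightarrow> smooth_at B q (\<lambda>y. V y f))"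

definition smooth_field_at ::
    "('p::topological_space, 'e::euclidean_space) chart set \<Rightarrow> 'p \<Rightarrow> ('p \<Rightarrow> 'p tvec) \<Rightarrow> bool"
  where "smooth_field_at A p X \<longleftrightarrow> smooth_field_along_at A A (\<lambda>x. x) p X"

definition vector_field ::
    "('p::topological_space, 'e::euclidean_space) chart set \<Rightarrow> ('p \<Rightarrow> 'p tvec) \<Rightarrow> bool"
  where "vector_field A X \<longleftrightarrow> (\<forall>p. smooth_field_at A p X)"

definition lie_bracket ::
    "('p::topological_space, 'e::euclidean_space) chart set \<Rightarrow> ('p \<Rightarrow> 'p tvec) \<Rightarrow>
     ('p \<Rightarrow> 'p tvec) \<Rightarrow> 'p \<Rightarrow> 'p tvec"
  where "lie_bracket A X Y p =
    (\<lambda>f. if smooth_at A p f then X p (\<lambda>x. Y x f) - Y p (\<lambda>x. X x f) else 0)"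

section \<open>Tensor fields and connections\<close>

definition linear_map_on :: "'a::real_vector set \<Rightarrow> ('a \<Rightarrow> 'b::real_vector) \<Rightarrow> bool"
  where "linear_map_on V f \<longleftrightarrow>
    (\<forall>u\<in>V. \<forall>v\<in>V. f (u + v) = f u + f v) \<and> (\<forall>r. \<forall>u\<in>V. f (r *\<^sub>R u) = r *\<^sub>R f u)"

definition one_form ::
    "('p::topological_space, 'e::euclidean_space) chart set \<Rightarrow> ('p \<Rightarrow> 'p tvec \<Rightarrow> real) \<Rightarrow> bool"
  where "one_form A \<eta> \<longleftrightarrow>
    (\<forall>p. linear_map_on (tangent_space A p) (\<eta> p)) \<and>
    (\<forall>p X. smooth_field_at A p X \<longrightarrow> smooth_at A p (\<lambda>x. \<eta> x (X x)))"

definition tensor_field_11 ::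
    "('p::topological_space, 'e::euclidean_space) chart set \<Rightarrow> ('p \<Rightarrow> 'p tvec \<Rightarrow> 'p tvec) \<Rightarrow> bool"
  where "tensor_field_11 A \<phi> \<longleftrightarrow>
    (\<forall>p. \<phi> p ` tangent_space A p \<subseteq> tangent_space A p \<and> linear_map_on (tangent_space A p) (\<phi> p)) \<and>
    (\<forall>p X. smooth_field_at A p X \<longrightarrow> smooth_field_at A p (\<lambda>x. \<phi> x (X x)))"

text \<open>Signature \<open>(-, +, \<dots>, +)\<close>: each tangent space has an orthonormal basis
  \<open>insert t E\<close> whose only timelike member is \<open>t\<close>.\<close>

definition lorentzian_metric ::
    "('p::topological_space, 'e::euclidean_space) chart set \<Rightarrow>
     ('p \<Rightarrow> 'p tvec \<Rightarrow> 'p tvec \<Rightarrow> real) \<Rightarrow> bool"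
  where "lorentzian_metric A g \<longleftrightarrow>
    (\<forall>p. \<forall>u\<in>tangent_space A p. linear_map_on (tangent_space A p) (g p u)) \<and>
    (\<forall>p. \<forall>u\<in>tangent_space A p. \<forall>v\<in>tangent_space A p. g p u v = g p v u) \<and>
    (\<forall>p X Y. smooth_field_at A p X \<longrightarrow> smooth_field_at A p Y \<longrightarrow>
       smooth_at A p (\<lambda>x. g x (X x) (Y x))) \<and>
    (\<forall>p. \<exists>t E. t \<notin> E \<and> independent (insert t E) \<and> span (insert t E) = tangent_space A p \<and>
       g p t t = -1 \<and> (\<forall>e\<in>E. g p t e = 0 \<and> g p e e = 1) \<and>
       (\<forall>e\<in>E. \<forall>f\<in>E. e \<noteq> f \<longrightarrow> g p e f = 0))"

text \<open>A connection is given by the values \<open>\<nabla>\<^sub>v X\<close> for a tangent vector \<open>v\<close> at \<open>p\<close> and a vector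
  field \<open>X\<close> that is smooth near \<open>p\<close>; that \<open>\<nabla>\<^sub>v X\<close> depends on the germ of \<open>X\<close> only follows from
  the Leibniz rule applied to indicator functions of neighbourhoods of \<open>p\<close>.\<close>

type_synonym 'p conn = "'p \<Rightarrow> 'p tvec \<Rightarrow> ('p \<Rightarrow> 'p tvec) \<Rightarrow> 'p tvec"

definition affine_connection ::
    "('p::topological_space, 'e::euclidean_space) chart set \<Rightarrow> 'p conn \<Rightarrow> bool"
  where "affine_connection A nabla \<longleftrightarrow>
    (\<forall>p X. smooth_field_at A p X \<longrightarrow>
       linear_map_on (tangent_space A p) (\<lambda>v. nabla p v X) \<and>
       (\<forall>v\<in>tangent_space A p. nabla p v X \<in> tangent_space A p)) \<and>
    (\<forall>p X Y. \<forall>v\<in>tangent_space A p. smooth_field_at A p X \<longrightarrow> smooth_field_at A p Y \<longrightarrow>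
       nabla p v (\<lambda>x. X x + Y x) = nabla p v X + nabla p v Y) \<and>
    (\<forall>p f X. \<forall>v\<in>tangent_space A p. smooth_at A p f \<longrightarrow> smooth_field_at A p X \<longrightarrow>
       nabla p v (\<lambda>x. f x *\<^sub>R X x) = v f *\<^sub>R X p + f p *\<^sub>R nabla p v X) \<and>
    (\<forall>p X Y. smooth_field_at A p X \<longrightarrow> smooth_field_at A p Y \<longrightarrow>
       smooth_field_at A p (\<lambda>x. nabla x (X x) Y))"

definition levi_civita ::
    "('p::topological_space, 'e::euclidean_space) chart set \<Rightarrow>
     ('p \<Rightarrow> 'p tvec \<Rightarrow> 'p tvec \<Rightarrow> real) \<Rightarrow> 'p conn \<Rightarrow> bool"
  where "levi_civita A g nabla \<longleftrightarrow>
    affine_connection A nabla \<and>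
    (\<forall>p X Y. smooth_field_at A p X \<longrightarrow> smooth_field_at A p Y \<longrightarrow>
       nabla p (X p) Y - nabla p (Y p) X = lie_bracket A X Y p) \<and>
    (\<forall>p X Y. \<forall>v\<in>tangent_space A p. smooth_field_at A p X \<longrightarrow> smooth_field_at A p Y \<longrightarrow>
       v (\<lambda>x. g x (X x) (Y x)) = g p (nabla p v X) (Y p) + g p (X p) (nabla p v Y))"

text \<open>For vector fields along a map \<open>i\<close> (tangent or normal fields of a submanifold, say) the
  derivative \<open>\<nabla>\<^sub>v V\<close> is the one of the pullback connection.  It is determined uniquely by the
  following properties, since near \<open>i q\<close> there are local frames of vector fields.\<close>

definition pullback_connection ::
    "('q::topological_space, 'm::euclidean_space) chart set \<Rightarrow>
     ('p::topological_space, 'n::euclidean_space) chart set \<Rightarrow> ('q \<Rightarrow> 'p) \<Rightarrow> 'p conn \<Rightarrow>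
     ('q \<Rightarrow> 'q tvec \<Rightarrow> ('q \<Rightarrow> 'p tvec) \<Rightarrow> 'p tvec) \<Rightarrow> bool"
  where "pullback_connection B A i nabla nabla_i \<longleftrightarrow>
    (\<forall>q V. smooth_field_along_at B A i q V \<longrightarrow>
       linear_map_on (tangent_space B q) (\<lambda>v. nabla_i q v V) \<and>
       (\<forall>v\<in>tangent_space B q. nabla_i q v V \<in> tangent_space A (i q))) \<and>
    (\<forall>q V V'. \<forall>v\<in>tangent_space B q.
       smooth_field_along_at B A i q V \<longrightarrow> smooth_field_along_at B A i q V' \<longrightarrow>
       nabla_i q v (\<lambda>y. V y + V' y) = nabla_i q v V + nabla_i q v V') \<and>
    (\<forall>q f V. \<forall>v\<in>tangent_space B q. smooth_at B q f \<longrightarrow> smooth_field_along_at B A i q V \<longrightarrow>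
       nabla_i q v (\<lambda>y. f y *\<^sub>R V y) = v f *\<^sub>R V q + f q *\<^sub>R nabla_i q v V) \<and>
    (\<forall>q X. \<forall>v\<in>tangent_space B q. smooth_field_at A (i q) X \<longrightarrow>
       nabla_i q v (\<lambda>y. X (i y)) = nabla (i q) (pushforward A i q v) X)"

section \<open>LP-Sasakian manifolds\<close>

definition LP_Sasakian ::
    "('p::topological_space, 'e::euclidean_space) chart set \<Rightarrow> ('p \<Rightarrow> 'p tvec \<Rightarrow> 'p tvec) \<Rightarrow>
     ('p \<Rightarrow> 'p tvec) \<Rightarrow> ('p \<Rightarrow> 'p tvec \<Rightarrow> real) \<Rightarrow> ('p \<Rightarrow> 'p tvec \<Rightarrow> 'p tvec \<Rightarrow> real) \<Rightarrow>
     'p conn \<Rightarrow> bool"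
  where "LP_Sasakian A \<phi> \<xi> \<eta> g nabla \<longleftrightarrow>
    tensor_field_11 A \<phi> \<and> vector_field A \<xi> \<and> one_form A \<eta> \<and>
    lorentzian_metric A g \<and> levi_civita A g nabla \<and>
    (\<forall>p. \<eta> p (\<xi> p) = -1) \<and>
    (\<forall>p. \<forall>u\<in>tangent_space A p. \<phi> p (\<phi> p u) = u + \<eta> p u *\<^sub>R \<xi> p) \<and>
    (\<forall>p. \<forall>u\<in>tangent_space A p. \<forall>v\<in>tangent_space A p.
       g p (\<phi> p u) (\<phi> p v) = g p u v + \<eta> p u * \<eta> p v) \<and>
    (\<forall>p. \<forall>u\<in>tangent_space A p. g p u (\<xi> p) = \<eta> p u) \<and>
    (\<forall>p. \<forall>u\<in>tangent_space A p. nabla p u \<xi> = \<phi> p u) \<and>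
    (\<forall>p V. \<forall>u\<in>tangent_space A p. smooth_field_at A p V \<longrightarrow>
       nabla p u (\<lambda>x. \<phi> x (V x)) - \<phi> p (nabla p u V) =
         g p u (V p) *\<^sub>R \<xi> p + \<eta> p (V p) *\<^sub>R u + (2 * \<eta> p u * \<eta> p (V p)) *\<^sub>R \<xi> p)"

definition generalized_symmetric_metric_connection ::
    "('p::topological_space, 'e::euclidean_space) chart set \<Rightarrow> ('p \<Rightarrow> 'p tvec \<Rightarrow> 'p tvec) \<Rightarrow>
     ('p \<Rightarrow> 'p tvec) \<Rightarrow> ('p \<Rightarrow> 'p tvec \<Rightarrow> real) \<Rightarrow> ('p \<Rightarrow> 'p tvec \<Rightarrow> 'p tvec \<Rightarrow> real) \<Rightarrow>
     'p conn \<Rightarrow> ('p \<Rightarrow> real) \<Rightarrow> ('p \<Rightarrow> real) \<Rightarrow> 'p conn \<Rightarrow> bool"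
  where "generalized_symmetric_metric_connection A \<phi> \<xi> \<eta> g nabla \<alpha> \<beta> nabla_bar \<longleftrightarrow>
    smooth_fun A \<alpha> \<and> smooth_fun A \<beta> \<and>
    (\<forall>p V. \<forall>u\<in>tangent_space A p. smooth_field_at A p V \<longrightarrow>
       nabla_bar p u V = nabla p u V
         + \<alpha> p *\<^sub>R (\<eta> p (V p) *\<^sub>R u - g p u (V p) *\<^sub>R \<xi> p)
         + \<beta> p *\<^sub>R (\<eta> p (V p) *\<^sub>R \<phi> p u - g p (\<phi> p u) (V p) *\<^sub>R \<xi> p))"

section \<open>Distributions\<close>

text \<open>Smooth distributions of constant rank, given near each point by a smooth local frame.\<close>

definition smooth_distribution ::
    "('q::topological_space, 'm::euclidean_space) chart set \<Rightarrow> ('q \<Rightarrow> 'q tvec set) \<Rightarrow> bool"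
  where "smooth_distribution B D \<longleftrightarrow>
    (\<exists>k. (\<forall>q. D q \<subseteq> tangent_space B q \<and> subspace (D q) \<and> dim (D q) = k) \<and>
       (\<forall>q. \<exists>X. (\<forall>j<k. smooth_field_at B q (X j)) \<and>
          (\<forall>\<^sub>F y in nhds q. D y = span ((\<lambda>j. X j y) ` {..<k}))))"

definition smooth_section ::
    "('q::topological_space, 'm::euclidean_space) chart set \<Rightarrow> ('q \<Rightarrow> 'q tvec set) \<Rightarrow>
     ('q \<Rightarrow> 'q tvec) \<Rightarrow> bool"
  where "smooth_section B D Y \<longleftrightarrow> vector_field B Y \<and> (\<forall>q. Y q \<in> D q)"

definition euclidean_atlas :: "('e::euclidean_space, 'e) chart set"
  where "euclidean_atlas = {(UNIV, id)}"

text \<open>Through every point there is an integral manifold, i.e. an immersed submanifold of \<open>M\<close>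
  whose tangent spaces are the spaces of the distribution.  It is given by a parametrization
  \<open>\<sigma>\<close> restricted to an open subset \<open>W \<inter> S\<close> of a linear subspace \<open>S\<close> of the model space of \<open>M\<close>;
  composing with a projection onto \<open>S\<close> extends any smooth map on such a set to an open subset of
  the model space, so that \<open>\<sigma>\<close> may be taken smooth on an open set \<open>W\<close>.\<close>

definition integrable_distribution ::
    "('q::topological_space, 'm::euclidean_space) chart set \<Rightarrow> ('q \<Rightarrow> 'q tvec set) \<Rightarrow> bool"
  where "integrable_distribution B D \<longleftrightarrow>
    (\<forall>q. \<exists>(\<sigma> :: 'm \<Rightarrow> 'q) W S.
       open W \<and> 0 \<in> W \<and> subspace S \<and> \<sigma> 0 = q \<and>
       (\<forall>s\<in>W. smooth_map_at euclidean_atlas B \<sigma> s) \<and>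
       (\<forall>s\<in>W \<inter> S.
          let T = coord_vec euclidean_atlas (UNIV, id) s ` S
          in inj_on (pushforward B \<sigma> s) T \<and> pushforward B \<sigma> s ` T = D (\<sigma> s)))"

section \<open>CR-submanifolds\<close>

text \<open>The submanifold is \<open>'q\<close> with atlas \<open>B\<close> and immersion \<open>i\<close>; the induced metric is the
  pullback of \<open>g\<close>.\<close>

definition orth_complement ::
    "('q::topological_space, 'm::euclidean_space) chart set \<Rightarrow>
     ('p::topological_space, 'n::euclidean_space) chart set \<Rightarrow> ('q \<Rightarrow> 'p) \<Rightarrow>
     ('p \<Rightarrow> 'p tvec \<Rightarrow> 'p tvec \<Rightarrow> real) \<Rightarrow> ('q \<Rightarrow> 'q tvec set) \<Rightarrow> 'q \<Rightarrow> 'q tvec set"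
  where "orth_complement B A i g D q =
    {v \<in> tangent_space B q. \<forall>u\<in>D q. g (i q) (pushforward A i q v) (pushforward A i q u) = 0}"

definition normal_space ::
    "('q::topological_space, 'm::euclidean_space) chart set \<Rightarrow>
     ('p::topological_space, 'n::euclidean_space) chart set \<Rightarrow> ('q \<Rightarrow> 'p) \<Rightarrow>
     ('p \<Rightarrow> 'p tvec \<Rightarrow> 'p tvec \<Rightarrow> real) \<Rightarrow> 'q \<Rightarrow> 'p tvec set"
  where "normal_space B A i g q =
    {w \<in> tangent_space A (i q). \<forall>u\<in>tangent_space B q. g (i q) w (pushforward A i q u) = 0}"

definition CR_submanifold ::
    "('q::t2_space, 'm::euclidean_space) chart set \<Rightarrow>
     ('p::topological_space, 'n::euclidean_space) chart set \<Rightarrow> ('q \<Rightarrow> 'p) \<Rightarrow>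
     ('p \<Rightarrow> 'p tvec \<Rightarrow> 'p tvec) \<Rightarrow> ('p \<Rightarrow> 'p tvec) \<Rightarrow> ('p \<Rightarrow> 'p tvec \<Rightarrow> 'p tvec \<Rightarrow> real) \<Rightarrow>
     ('q \<Rightarrow> 'q tvec set) \<Rightarrow> bool"
  where "CR_submanifold B A i \<phi> \<xi> g D \<longleftrightarrow>
    immersion B A i \<and>
    (\<forall>q. \<xi> (i q) \<in> pushforward A i q ` tangent_space B q) \<and>
    smooth_distribution B D \<and> smooth_distribution B (orth_complement B A i g D) \<and>
    (\<forall>q. D q \<inter> orth_complement B A i g D q = {0} \<and>
       {u + v | u v. u \<in> D q \<and> v \<in> orth_complement B A i g D q} = tangent_space B q) \<and>
    (\<forall>q. \<phi> (i q) ` pushforward A i q ` D q \<subseteq> pushforward A i q ` D q) \<and>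
    (\<forall>q. \<phi> (i q) ` pushforward A i q ` orth_complement B A i g D q \<subseteq> normal_space B A i g q)"

definition xi_vertical ::
    "('q::topological_space, 'm::euclidean_space) chart set \<Rightarrow>
     ('p::topological_space, 'n::euclidean_space) chart set \<Rightarrow> ('q \<Rightarrow> 'p) \<Rightarrow>
     ('p \<Rightarrow> 'p tvec) \<Rightarrow> ('p \<Rightarrow> 'p tvec \<Rightarrow> 'p tvec \<Rightarrow> real) \<Rightarrow> ('q \<Rightarrow> 'q tvec set) \<Rightarrow> bool"
  where "xi_vertical B A i \<xi> g D \<longleftrightarrow>
    (\<exists>X. smooth_section B (orth_complement B A i g D) X \<and>
       (\<forall>q. pushforward A i q (X q) = \<xi> (i q)))"

text \<open>The tangent vector \<open>A\<^sub>N v\<close> at \<open>q\<close> from the Weingarten decomposition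
  \<open>\<nabla>\<^sub>v N = - A\<^sub>N v + \<nabla>\<^sup>\<bottom>\<^sub>v N\<close>; it is unique where the induced metric is nondegenerate.\<close>

definition shape_operator ::
    "('q::topological_space, 'm::euclidean_space) chart set \<Rightarrow>
     ('p::topological_space, 'n::euclidean_space) chart set \<Rightarrow> ('q \<Rightarrow> 'p) \<Rightarrow>
     ('p \<Rightarrow> 'p tvec \<Rightarrow> 'p tvec \<Rightarrow> real) \<Rightarrow>
     ('q \<Rightarrow> 'q tvec \<Rightarrow> ('q \<Rightarrow> 'p tvec) \<Rightarrow> 'p tvec) \<Rightarrow> ('q \<Rightarrow> 'p tvec) \<Rightarrow> 'q \<Rightarrow> 'q tvec \<Rightarrow> 'q tvec"
  where "shape_operator B A i g nabla_i N q v =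
    (THE a. a \<in> tangent_space B q \<and>
       nabla_i q v N + pushforward A i q a \<in> normal_space B A i g q)"

end

theory Submission
  imports Defs
begin

text \<open>The identity \<open>g(\<phi> V, V) = 0\<close> is differentiated, so it must hold on a
  neighbourhood: a single vector of \<open>Dperp q\<close> is not enough. The local frames in
  \<open>smooth_distribution\<close> supply sections, and their values span \<open>Dperp q\<close>.
  The direction \<open>\<xi>\<close> is special since U = \<open>\<xi>\<close> in the formula for
  the derivative of \<open>\<phi>\<close> yields the coefficients 1 + 1 - 2 = 0. The symmetry of
  \<open>\<phi>\<close> is not an axiom; it is derived from \<open>\<phi> \<xi> = 0\<close> and the
  vanishing of \<open>\<eta>\<close> on the image of \<open>\<phi>\<close>. The vector
  \<open>V + \<eta>(V) \<xi>\<close> is the component of V orthogonal to \<open>\<xi>\<close>. Its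
  square is g(V,V) + \<open>\<eta>(V)\<close>^2, which is the square of \<open>\<phi> V\<close>; the
  Lorentzian signature then turns null into zero. The obstacle is that V lives on M only, whereas
  \<open>nabla\<close> acts on fields of the ambient manifold. Hence the bracket and product rules
  are applied to the coordinate fields of an ambient chart, with coefficients that are functions on
  M.\<close>

text \<open>Both sides of the equivalence hold, because \<open>D\<^sup>\<bottom>\<close> is spanned by \<open>\<xi>\<close>.  Let \<open>X\<close> be the field on
  \<open>M\<close> with \<open>i\<^sub>* X = \<xi>\<close>, let \<open>Y\<close> be a local section of \<open>D\<^sup>\<bottom>\<close> and \<open>V = i\<^sub>* Y\<close>.  Since \<open>\<phi> V\<close> is normal,
  \<open>g(\<phi> V, V) = 0\<close>.  Differentiating along \<open>X\<close>, where \<open>\<nabla>\<^sub>\<xi> \<phi> = 0\<close> and \<open>\<phi>\<close> is symmetric, gives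
  \<open>0 = 2 g(\<phi> V, \<nabla>\<^sub>X V)\<close>.  But \<open>\<nabla>\<^sub>X V = \<nabla>\<^sub>V \<xi> + i\<^sub>* [X, Y] = \<phi> V + i\<^sub>* [X, Y]\<close> and the bracket is
  tangent to \<open>M\<close>, so \<open>g(\<phi> V, \<phi> V) = 0\<close>.  Hence \<open>V + \<eta>(V) \<xi>\<close> is a null vector orthogonal to the
  timelike \<open>\<xi>\<close>, and it vanishes.

  A line field is integrable, by the existence of integral curves.  On the other side \<open>\<phi> Y = 0\<close>
  for every section \<open>Y\<close> of \<open>D\<^sup>\<bottom>\<close>, so that the shape operators cancel, and \<open>\<eta>(Y) Z = \<eta>(Z) Y\<close>.\<close>

section \<open>Calculus of smooth maps between Euclidean spaces\<close>

text \<open>A derivative at x sees only the values near x, so on an open set agreement of two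
  functions passes to their derivatives.\<close>

lemma Ck_on_imp_cong:
  assumes "open S" "\<And>x. x \<in> S \<Longrightarrow> f x = g x" "Ck_on k S f"
  shows "Ck_on k S g"
  using assms(2,3)
proof (induction k arbitrary: f g)
  case 0
  then show ?case using continuous_on_cong by (metis Ck_on.simps(1))
next
  case (Suc k)
  have f: "f differentiable (at x)" if "x \<in> S" for x
    using Suc.prems(2) that assms(1) by (simp add: differentiable_on_eq_differentiable_at)
  have eq: "frechet_derivative f (at x) = frechet_derivative g (at x)" if "x \<in> S" for x
    using frechet_derivative_transform_within_open[OF f[OF that] assms(1) that] Suc.prems(1) by blast
  have "(g has_derivative frechet_derivative f (at x)) (at x)" if "x \<in> S" for x
    using has_derivative_transform_within_open[OF _ assms(1) that] f[OF that] Suc.prems(1)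
    by (metis frechet_derivative_works)
  then have "g differentiable_on S"
    using assms(1) by (auto simp: differentiable_on_eq_differentiable_at differentiable_def)
  moreover have "Ck_on k S (\<lambda>x. frechet_derivative g (at x) v)" for v
    by (rule Suc.IH[of "\<lambda>x. frechet_derivative f (at x) v"]) (use eq Suc.prems(2) in auto)
  ultimately show ?case by simp
qed

lemma Ck_on_cong:
  assumes "open S" "\<And>x. x \<in> S \<Longrightarrow> f x = g x"
  shows "Ck_on k S f \<longleftrightarrow> Ck_on k S g"
  using Ck_on_imp_cong[of S f g] Ck_on_imp_cong[of S g f] assms by auto

text \<open>Allows any explicit derivative in place of the chosen \<open>frechet_derivative\<close>;
  the closure proofs rest on this.\<close>

lemma Ck_on_SucI:
  assumes "open S" "\<And>x. x \<in> S \<Longrightarrow> (f has_derivative f' x) (at x)" "\<And>v. Ck_on k S (\<lambda>x. f' x v)"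
  shows "Ck_on (Suc k) S f"
proof -
  have "f differentiable_on S"
    using assms by (auto simp: differentiable_on_eq_differentiable_at differentiable_def)
  moreover have "Ck_on k S (\<lambda>x. frechet_derivative f (at x) v)" for v
    by (rule Ck_on_imp_cong[OF assms(1) _ assms(3)[of v]]) (simp add: frechet_derivative_at[OF assms(2)])
  ultimately show ?thesis by simp
qed

lemma Ck_on_SucD:
  assumes "Ck_on (Suc k) S f" "open S" "x \<in> S"
  shows "(f has_derivative frechet_derivative f (at x)) (at x)"
  using assms by (simp add: differentiable_on_eq_differentiable_at flip: frechet_derivative_works)

text \<open>The product and chain rules combine derivatives with undifferentiated factors, which
  must therefore be available at the lower order too.\<close>

lemma Ck_on_Suc_imp: "Ck_on (Suc k) S f \<Longrightarrow> Ck_on k S f"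
proof (induction k arbitrary: f)
  case 0
  then show ?case by (simp add: differentiable_imp_continuous_on)
next
  case (Suc k)
  then show ?case by (metis Ck_on.simps(2))
qed

lemma Ck_on_subset:
  assumes "Ck_on k T f" "S \<subseteq> T" "open S" "open T"
  shows "Ck_on k S f"
  using assms(1)
proof (induction k arbitrary: f)
  case 0
  then show ?case using assms continuous_on_subset by auto
next
  case (Suc k)
  then show ?case using assms differentiable_on_subset by auto
qed

section \<open>Closure of \<open>Ck_on\<close> and \<open>smooth_on\<close> under algebra and
  composition\<close>

lemma Ck_on_const: "open S \<Longrightarrow> Ck_on k S (\<lambda>x. c)"
proof (induction k arbitrary: c)
  case (Suc k)
  show ?case by (rule Ck_on_SucI[OF Suc.prems, of _ "\<lambda>x v. 0"]) (use Suc in auto)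
qed simp

lemma Ck_on_bounded_linear:
  assumes "open S" "bounded_linear h"
  shows "Ck_on k S f \<Longrightarrow> Ck_on k S (\<lambda>x. h (f x))"
proof (induction k arbitrary: f)
  case 0
  then show ?case using bounded_linear.continuous_on[OF assms(2)] by simp
next
  case (Suc k)
  show ?case
    by (rule Ck_on_SucI[OF assms(1), of _ "\<lambda>x v. h (frechet_derivative f (at x) v)"])
      (use Suc assms in \<open>auto intro!: bounded_linear.has_derivative[OF assms(2)] Ck_on_SucD\<close>)
qed

lemma Ck_on_id: "open S \<Longrightarrow> Ck_on k S (\<lambda>x. x)"
  by (cases k) (auto intro!: Ck_on_SucI[where f' = "\<lambda>x v. v"] Ck_on_const simp del: Ck_on.simps(2))

lemma Ck_on_add:
  assumes "open S"
  shows "Ck_on k S f \<Longrightarrow> Ck_on k S g \<Longrightarrow> Ck_on k S (\<lambda>x. f x + g x)"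
proof (induction k arbitrary: f g)
  case 0
  then show ?case by (auto intro: continuous_intros)
next
  case (Suc k)
  show ?case
    by (rule Ck_on_SucI[OF assms, of _ "\<lambda>x v. frechet_derivative f (at x) v + frechet_derivative g (at x) v"])
      (use Suc assms in \<open>auto intro!: has_derivative_add Ck_on_SucD\<close>)
qed

lemma Ck_on_scaleR:
  assumes "open S"
  shows "Ck_on k S f \<Longrightarrow> Ck_on k S g \<Longrightarrow> Ck_on k S (\<lambda>x. f x *\<^sub>R g x)"
proof (induction k arbitrary: f g)
  case 0
  then show ?case by (auto intro: continuous_intros)
next
  case (Suc k)
  show ?case
  proof (rule Ck_on_SucI[OF assms, of _ "\<lambda>x v. f x *\<^sub>R frechet_derivative g (at x) v + frechet_derivative f (at x) v *\<^sub>R g x"])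
    show "((\<lambda>x. f x *\<^sub>R g x) has_derivative
        (\<lambda>v. f x *\<^sub>R frechet_derivative g (at x) v + frechet_derivative f (at x) v *\<^sub>R g x)) (at x)"
      if "x \<in> S" for x
      using Suc.prems that assms by (intro has_derivative_scaleR Ck_on_SucD)
    show "Ck_on k S (\<lambda>x. f x *\<^sub>R frechet_derivative g (at x) v + frechet_derivative f (at x) v *\<^sub>R g x)" for v
      by (intro Ck_on_add Suc.IH) (use Suc.prems assms Ck_on_Suc_imp in auto)
  qed
qed

lemma Ck_on_sum:
  assumes "open S" "\<And>b. b \<in> I \<Longrightarrow> Ck_on k S (f b)"
  shows "Ck_on k S (\<lambda>x. \<Sum>b\<in>I. f b x)"
  using assms(2) by (induction I rule: infinite_finite_induct) (auto intro: Ck_on_const Ck_on_add assms(1))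

text \<open>\<open>Ck_on\<close> controls derivatives in fixed directions only, while the chain rule
  produces a direction that moves with the point. Expanding in the basis moves this dependence into
  scalar coefficients.\<close>

lemma has_derivative_Basis_sum:
  fixes g :: "'b::euclidean_space \<Rightarrow> 'c::real_normed_vector"
  assumes "(g has_derivative g') F"
  shows "g' v = (\<Sum>b\<in>Basis. (v \<bullet> b) *\<^sub>R g' b)"
proof -
  have l: "linear g'" using assms by (rule has_derivative_linear)
  have "g' v = g' (\<Sum>b\<in>Basis. (v \<bullet> b) *\<^sub>R b)" by (simp add: euclidean_representation)
  also have "\<dots> = (\<Sum>b\<in>Basis. (v \<bullet> b) *\<^sub>R g' b)"
    by (simp add: linear_sum[OF l] linear_scale[OF l])
  finally show ?thesis .
qed

lemma Ck_on_compose: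
  fixes f :: "'a::euclidean_space \<Rightarrow> 'b::euclidean_space" and g :: "'b \<Rightarrow> 'c::real_normed_vector"
  assumes "open S" "open T" "f ` S \<subseteq> T"
  shows "Ck_on k S f \<Longrightarrow> Ck_on k T g \<Longrightarrow> Ck_on k S (\<lambda>x. g (f x))"
proof (induction k arbitrary: g)
  case 0
  then show ?case using assms continuous_on_compose2 by auto
next
  case (Suc k)
  let ?f = "\<lambda>x. frechet_derivative f (at x)" and ?g = "\<lambda>x. frechet_derivative g (at x)"
  show ?case
  proof (rule Ck_on_SucI[OF assms(1), of _ "\<lambda>x v. \<Sum>b\<in>Basis. (?f x v \<bullet> b) *\<^sub>R ?g (f x) b"])
    fix x assume x: "x \<in> S"
    have g: "(g has_derivative ?g (f x)) (at (f x))"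
      using Ck_on_SucD[OF Suc.prems(2)] assms x by auto
    have "(\<lambda>v. \<Sum>b\<in>Basis. (?f x v \<bullet> b) *\<^sub>R ?g (f x) b) = (\<lambda>v. ?g (f x) (?f x v))"
      by (rule ext) (rule has_derivative_Basis_sum[OF g, symmetric])
    then show "((\<lambda>x. g (f x)) has_derivative (\<lambda>v. \<Sum>b\<in>Basis. (?f x v \<bullet> b) *\<^sub>R ?g (f x) b)) (at x)"
      using has_derivative_compose[OF Ck_on_SucD[OF Suc.prems(1) assms(1) x] g] by simp
  next
    fix v
    have "Ck_on k S (\<lambda>x. ?f x v \<bullet> b)" for b
      by (rule Ck_on_bounded_linear[OF assms(1) bounded_linear_inner_left]) (use Suc.prems in auto)
    moreover have "Ck_on k S (\<lambda>x. ?g (f x) b)" for b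
      by (rule Suc.IH) (use Suc.prems Ck_on_Suc_imp in auto)
    ultimately show "Ck_on k S (\<lambda>x. \<Sum>b\<in>Basis. (?f x v \<bullet> b) *\<^sub>R ?g (f x) b)"
      by (intro Ck_on_sum Ck_on_scaleR assms)
  qed
qed

lemma smooth_on_cong: "open S \<Longrightarrow> (\<And>x. x \<in> S \<Longrightarrow> f x = g x) \<Longrightarrow> smooth_on S f \<longleftrightarrow> smooth_on S g"
  unfolding smooth_on_def using Ck_on_cong by metis

lemma smooth_on_subset: "smooth_on T f \<Longrightarrow> S \<subseteq> T \<Longrightarrow> open S \<Longrightarrow> open T \<Longrightarrow> smooth_on S f"
  unfolding smooth_on_def using Ck_on_subset by blast

lemma smooth_on_const: "open S \<Longrightarrow> smooth_on S (\<lambda>x. c)"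
  unfolding smooth_on_def using Ck_on_const by blast

lemma smooth_on_id: "open S \<Longrightarrow> smooth_on S (\<lambda>x. x)"
  unfolding smooth_on_def using Ck_on_id by blast

lemma smooth_on_bounded_linear:
  "open S \<Longrightarrow> bounded_linear h \<Longrightarrow> smooth_on S f \<Longrightarrow> smooth_on S (\<lambda>x. h (f x))"
  by (simp add: smooth_on_def Ck_on_bounded_linear)

lemma smooth_on_add: "open S \<Longrightarrow> smooth_on S f \<Longrightarrow> smooth_on S g \<Longrightarrow> smooth_on S (\<lambda>x. f x + g x)"
  by (simp add: smooth_on_def Ck_on_add)

lemma smooth_on_scaleR:
  "open S \<Longrightarrow> smooth_on S f \<Longrightarrow> smooth_on S g \<Longrightarrow> smooth_on S (\<lambda>x. f x *\<^sub>R g x)"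
  by (simp add: smooth_on_def Ck_on_scaleR)

lemma smooth_on_sum:
  "open S \<Longrightarrow> (\<And>b. b \<in> I \<Longrightarrow> smooth_on S (f b)) \<Longrightarrow> smooth_on S (\<lambda>x. \<Sum>b\<in>I. f b x)"
  by (simp add: smooth_on_def Ck_on_sum)

lemma smooth_on_compose:
  fixes f :: "'a::euclidean_space \<Rightarrow> 'b::euclidean_space"
  shows "open S \<Longrightarrow> open T \<Longrightarrow> f ` S \<subseteq> T \<Longrightarrow> smooth_on S f \<Longrightarrow> smooth_on T g \<Longrightarrow> smooth_on S (\<lambda>x. g (f x))"
  by (simp add: smooth_on_def Ck_on_compose)

lemma smooth_on_has_derivative:
  "smooth_on S f \<Longrightarrow> open S \<Longrightarrow> x \<in> S \<Longrightarrow> (f has_derivative frechet_derivative f (at x)) (at x)"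
  unfolding smooth_on_def using Ck_on_SucD by blast

lemma smooth_on_frechet_derivative: "smooth_on S f \<Longrightarrow> smooth_on S (\<lambda>x. frechet_derivative f (at x) v)"
  unfolding smooth_on_def using Ck_on.simps(2) by blast

lemma smooth_on_imp_continuous_on: "smooth_on S f \<Longrightarrow> continuous_on S f"
  unfolding smooth_on_def using Ck_on.simps(1) by blast

text \<open>Needed where each point of a chart comes with its own neighbourhood of
  smoothness.\<close>

lemma Ck_on_local:
  assumes "open S"
  shows "(\<And>x. x \<in> S \<Longrightarrow> \<exists>U. open U \<and> x \<in> U \<and> Ck_on k U f) \<Longrightarrow> Ck_on k S f"
proof (induction k arbitrary: f)
  case 0
  have "isCont f x" if "x \<in> S" for x
    using 0[OF that] by (auto simp: continuous_on_eq_continuous_at)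
  then show ?case by (simp add: continuous_at_imp_continuous_on)
next
  case (Suc k)
  show ?case
  proof (rule Ck_on_SucI[OF assms])
    show "(f has_derivative frechet_derivative f (at x)) (at x)" if "x \<in> S" for x
      using Suc.prems[OF that] Ck_on_SucD by blast
    show "Ck_on k S (\<lambda>x. frechet_derivative f (at x) v)" for v
    proof (rule Suc.IH)
      fix x assume "x \<in> S"
      then obtain U where "open U" "x \<in> U" "Ck_on (Suc k) U f" using Suc.prems by blast
      then show "\<exists>U. open U \<and> x \<in> U \<and> Ck_on k U (\<lambda>x. frechet_derivative f (at x) v)" by auto
    qed
  qed
qed

lemma smooth_on_local:
  assumes "open S" "\<And>x. x \<in> S \<Longrightarrow> \<exists>U. open U \<and> x \<in> U \<and> smooth_on U f"
  shows "smooth_on S f"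
  unfolding smooth_on_def
proof
  show "Ck_on k S f" for k
    by (rule Ck_on_local[OF assms(1)]) (use assms(2) smooth_on_def in blast)
qed

text \<open>The mean value theorem, applied in the direction \<open>u\<close> and then in the direction \<open>v\<close>.\<close>

lemma second_difference_tendsto:
  fixes f :: "'a::euclidean_space \<Rightarrow> real"
  assumes S: "open S" "x \<in> S"
    and f: "\<And>y. y \<in> S \<Longrightarrow> (f has_derivative f' y) (at y)"
    and f': "\<And>y. y \<in> S \<Longrightarrow> ((\<lambda>y. f' y u) has_derivative f'' y) (at y)"
    and cont: "continuous_on S (\<lambda>y. f'' y v)"
  shows "((\<lambda>s. (f (x + s *\<^sub>R u + s *\<^sub>R v) - f (x + s *\<^sub>R u) - f (x + s *\<^sub>R v) + f x) / s\<^sup>2)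
    \<longlongrightarrow> f'' x v) (at_right 0)"
proof (rule tendstoI)
  fix e :: real assume e: "e > 0"
  have "isCont (\<lambda>y. f'' y v) x" using cont S continuous_on_eq_continuous_at by blast
  then have "\<forall>\<^sub>F y in nhds x. dist (f'' y v) (f'' x v) < e"
    using e by (metis isCont_def tendsto_at_iff_tendsto_nhds tendstoD)
  moreover have "\<forall>\<^sub>F y in nhds x. y \<in> S" using S by (rule eventually_nhds_in_open)
  ultimately have "\<forall>\<^sub>F y in nhds x. dist (f'' y v) (f'' x v) < e \<and> y \<in> S" by eventually_elim auto
  then obtain r where r: "r > 0" "\<And>y. dist y x < r \<Longrightarrow> dist (f'' y v) (f'' x v) < e \<and> y \<in> S"
    unfolding eventually_nhds_metric by blast
  \<comment> \<open>The summand 1 keeps the denominator positive when u = v = 0 and makes the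
    distance estimate strict.\<close>
  define d where "d = r / (norm u + norm v + 1)"
  have d: "d > 0" unfolding d_def using r(1) by (simp add: add_nonneg_pos)
  have near: "dist (x + a *\<^sub>R u + b *\<^sub>R v) x < r" if "0 \<le> a" "a < d" "0 \<le> b" "b < d" for a b
  proof -
    have "dist (x + a *\<^sub>R u + b *\<^sub>R v) x = norm (a *\<^sub>R u + b *\<^sub>R v)" by (simp add: dist_norm)
    also have "\<dots> \<le> a * norm u + b * norm v"
      using norm_triangle_ineq[of "a *\<^sub>R u" "b *\<^sub>R v"] that by simp
    also have "\<dots> \<le> d * norm u + d * norm v"
      using that by (intro add_mono mult_right_mono) auto
    also have "\<dots> < d * (norm u + norm v + 1)" using d by (simp add: algebra_simps)
    also have "\<dots> = r" unfolding d_def using add_nonneg_pos[of "norm u + norm v" 1] by simp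
    finally show ?thesis .
  qed
  have "dist ((f (x + s *\<^sub>R u + s *\<^sub>R v) - f (x + s *\<^sub>R u) - f (x + s *\<^sub>R v) + f x) / s\<^sup>2) (f'' x v) < e"
    if s: "0 < s" "s < d" for s
  proof -
    have D: "DERIV (\<lambda>a. f (x + a *\<^sub>R u + b *\<^sub>R v)) a :> f' (x + a *\<^sub>R u + b *\<^sub>R v) u"
      if "0 \<le> a" "a \<le> s" "0 \<le> b" "b \<le> s" for a b
    proof -
      have y: "x + a *\<^sub>R u + b *\<^sub>R v \<in> S" using near[of a b] r(2) that s by auto
      have "((\<lambda>a. f (x + a *\<^sub>R u + b *\<^sub>R v)) has_derivative (\<lambda>h. f' (x + a *\<^sub>R u + b *\<^sub>R v) (h *\<^sub>R u))) (at a)"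
        by (rule has_derivative_compose[where f = "\<lambda>a. x + a *\<^sub>R u + b *\<^sub>R v" and x = a, OF _ f[OF y]]) (auto intro!: derivative_eq_intros)
      moreover have "linear (f' (x + a *\<^sub>R u + b *\<^sub>R v))" using f[OF y] has_derivative_linear by blast
      ultimately show ?thesis
        unfolding has_field_derivative_def by (simp add: linear_scale fun_eq_iff mult.commute[of _ "f' _ _"])
    qed
    have D': "DERIV (\<lambda>b. f' (x + a *\<^sub>R u + b *\<^sub>R v) u) b :> f'' (x + a *\<^sub>R u + b *\<^sub>R v) v"
      if "0 \<le> a" "a \<le> s" "0 \<le> b" "b \<le> s" for a b
    proof -
      have y: "x + a *\<^sub>R u + b *\<^sub>R v \<in> S" using near[of a b] r(2) that s by auto
      have "((\<lambda>b. f' (x + a *\<^sub>R u + b *\<^sub>R v) u) has_derivative (\<lambda>h. f'' (x + a *\<^sub>R u + b *\<^sub>R v) (h *\<^sub>R v))) (at b)"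
        by (rule has_derivative_compose[where f = "\<lambda>b. x + a *\<^sub>R u + b *\<^sub>R v" and x = b, OF _ f'[OF y]]) (auto intro!: derivative_eq_intros)
      moreover have "linear (f'' (x + a *\<^sub>R u + b *\<^sub>R v))" using f'[OF y] has_derivative_linear by blast
      ultimately show ?thesis
        unfolding has_field_derivative_def by (simp add: linear_scale fun_eq_iff mult.commute[of _ "f'' _ _"])
    qed
    have "\<exists>a. 0 < a \<and> a < s \<and>
       (f (x + s *\<^sub>R u + s *\<^sub>R v) - f (x + s *\<^sub>R u + 0 *\<^sub>R v)) - (f (x + 0 *\<^sub>R u + s *\<^sub>R v) - f (x + 0 *\<^sub>R u + 0 *\<^sub>R v))
         = (s - 0) * (f' (x + a *\<^sub>R u + s *\<^sub>R v) u - f' (x + a *\<^sub>R u + 0 *\<^sub>R v) u)"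
      by (rule MVT2[OF s(1)]) (intro DERIV_diff D; use s in simp)
    then obtain a where a: "0 < a" "a < s"
       "(f (x + s *\<^sub>R u + s *\<^sub>R v) - f (x + s *\<^sub>R u + 0 *\<^sub>R v)) - (f (x + 0 *\<^sub>R u + s *\<^sub>R v) - f (x + 0 *\<^sub>R u + 0 *\<^sub>R v))
         = (s - 0) * (f' (x + a *\<^sub>R u + s *\<^sub>R v) u - f' (x + a *\<^sub>R u + 0 *\<^sub>R v) u)" by blast
    have "\<exists>b. 0 < b \<and> b < s \<and>
       f' (x + a *\<^sub>R u + s *\<^sub>R v) u - f' (x + a *\<^sub>R u + 0 *\<^sub>R v) u = (s - 0) * f'' (x + a *\<^sub>R u + b *\<^sub>R v) v"
      by (rule MVT2[OF s(1)]) (intro D'; use a in simp)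
    then obtain b where b: "0 < b" "b < s"
       "f' (x + a *\<^sub>R u + s *\<^sub>R v) u - f' (x + a *\<^sub>R u + 0 *\<^sub>R v) u = (s - 0) * f'' (x + a *\<^sub>R u + b *\<^sub>R v) v"
      by blast
    have "f (x + s *\<^sub>R u + s *\<^sub>R v) - f (x + s *\<^sub>R u) - f (x + s *\<^sub>R v) + f x = s\<^sup>2 * f'' (x + a *\<^sub>R u + b *\<^sub>R v) v"
      using a(3) b(3) by (simp add: power2_eq_square)
    then show ?thesis using r(2) near[of a b] a b s by simp
  qed
  then show "\<forall>\<^sub>F s in at_right 0. dist ((f (x + s *\<^sub>R u + s *\<^sub>R v) - f (x + s *\<^sub>R u) - f (x + s *\<^sub>R v) + f x) / s\<^sup>2) (f'' x v) < e"
    unfolding eventually_at_right_field using d by auto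
qed

text \<open>The second difference is symmetric in u and v, and its quotient tends to either mixed
  derivative; limits are unique.\<close>

lemma symmetric_second_derivative:
  fixes f :: "'a::euclidean_space \<Rightarrow> real"
  assumes "smooth_on S f" "open S" "x \<in> S"
  shows "frechet_derivative (\<lambda>y. frechet_derivative f (at y) u) (at x) v
    = frechet_derivative (\<lambda>y. frechet_derivative f (at y) v) (at x) u"
proof -
  let ?q = "\<lambda>u v s. (f (x + s *\<^sub>R u + s *\<^sub>R v) - f (x + s *\<^sub>R u) - f (x + s *\<^sub>R v) + f x) / s\<^sup>2"
  have lim: "(?q u v \<longlongrightarrow> frechet_derivative (\<lambda>y. frechet_derivative f (at y) u) (at x) v) (at_right 0)" for u v
    using assms
    by (intro second_difference_tendsto[where f' = "\<lambda>y. frechet_derivative f (at y)" and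
          f'' = "\<lambda>z. frechet_derivative (\<lambda>y. frechet_derivative f (at y) u) (at z)"])
      (auto intro: smooth_on_has_derivative smooth_on_frechet_derivative smooth_on_imp_continuous_on)
  have eq: "?q v u = ?q u v" by (simp add: algebra_simps)
  show ?thesis
    by (rule tendsto_unique[OF trivial_limit_at_right_real lim[of u v] lim[of v u, unfolded eq]])
qed

section \<open>Integral curves\<close>

text \<open>Partial derivatives are bounded on a compact set, which bounds the operator norm of the
  derivative; convexity admits the mean value inequality.\<close>

lemma C1_lipschitz_on_compact_convex:
  fixes F :: "'a::euclidean_space \<Rightarrow> 'b::real_normed_vector"
  assumes "open S" "smooth_on S F" "K \<subseteq> S" "compact K" "convex K"
  obtains L where "L > 0" "\<And>x y. x \<in> K \<Longrightarrow> y \<in> K \<Longrightarrow> norm (F x - F y) \<le> L * norm (x - y)"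
proof -
  let ?F = "\<lambda>x. frechet_derivative F (at x)"
  have "\<exists>M. \<forall>x\<in>K. norm (?F x b) \<le> M" for b
  proof -
    have "continuous_on K (\<lambda>x. ?F x b)"
      using smooth_on_frechet_derivative[OF assms(2)] smooth_on_imp_continuous_on assms(3) continuous_on_subset
      by blast
    then have "bounded ((\<lambda>x. ?F x b) ` K)"
      using assms(4) compact_continuous_image compact_imp_bounded by blast
    then show ?thesis by (auto simp: bounded_iff)
  qed
  then obtain M where M: "\<And>b x. x \<in> K \<Longrightarrow> norm (?F x b) \<le> M b" by metis
  \<comment> \<open>Adding 1 makes the constant positive even if every bound is 0.\<close>
  define L where "L = (\<Sum>b\<in>Basis. \<bar>M b\<bar>) + 1"
  have L: "L > 0" unfolding L_def by (simp add: add_nonneg_pos sum_nonneg)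
  have der: "(F has_derivative ?F x) (at x)" if "x \<in> K" for x
    using smooth_on_has_derivative assms that by blast
  have "onorm (?F x) \<le> L" if x: "x \<in> K" for x
  proof (rule onorm_bound)
    fix v
    have "norm (?F x v) = norm (\<Sum>b\<in>Basis. (v \<bullet> b) *\<^sub>R ?F x b)"
      using has_derivative_Basis_sum[OF der[OF x]] by metis
    also have "\<dots> \<le> (\<Sum>b\<in>Basis. norm v * \<bar>M b\<bar>)"
    proof (rule sum_norm_le)
      fix b :: 'a assume "b \<in> Basis"
      moreover have "norm (?F x b) \<le> \<bar>M b\<bar>" using M[OF x, of b] by linarith
      ultimately show "norm ((v \<bullet> b) *\<^sub>R ?F x b) \<le> norm v * \<bar>M b\<bar>"
        using Basis_le_norm[of b v] by (auto intro!: mult_mono)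
    qed
    also have "\<dots> \<le> L * norm v"
      by (simp add: L_def algebra_simps flip: sum_distrib_left)
    finally show "norm (?F x v) \<le> L * norm v" .
  qed (use L in simp)
  then have "norm (F x - F y) \<le> L * norm (x - y)" if "x \<in> K" "y \<in> K" for x y
    using differentiable_bound[OF assms(5), of F ?F L x y] der that has_derivative_at_withinI by blast
  with L that show ?thesis by blast
qed

text \<open>The signed integral from 0 to t. The interval {0..t} is empty for negative t, so the
  integration starts at -h and the part up to 0 is subtracted.\<close>

definition integral_from_0 :: "real \<Rightarrow> (real \<Rightarrow> 'a::euclidean_space) \<Rightarrow> real \<Rightarrow> 'a"
  where "integral_from_0 h f t = integral {-h..t} f - integral {-h..0} f"

lemma integral_from_0_has_vector_derivative:
  assumes "continuous_on {-h..h} f" "t \<in> {-h..h}"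
  shows "(integral_from_0 h f has_vector_derivative f t) (at t within {-h..h})"
  unfolding integral_from_0_def
  using has_vector_derivative_diff[OF integral_has_vector_derivative[OF assms] has_vector_derivative_const]
  by simp

text \<open>The mean value inequality for the primitive treats both signs of t at once.\<close>

lemma norm_integral_from_0_le:
  assumes "continuous_on {-h..h} f" "t \<in> {-h..h}" "\<And>s. s \<in> {-h..h} \<Longrightarrow> norm (f s) \<le> C"
  shows "norm (integral_from_0 h f t) \<le> C * h"
proof -
  have h: "0 \<in> {-h..h}" using assms(2) by auto
  have "onorm (\<lambda>r. r *\<^sub>R f s) \<le> C" if "s \<in> {-h..h}" for s
    using assms(3)[OF that] order_trans[OF norm_ge_zero assms(3)[OF that]]
    by (intro onorm_bound) (auto simp: mult.commute[of C] intro!: mult_left_mono)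
  then have "norm (integral_from_0 h f t - integral_from_0 h f 0) \<le> C * norm (t - 0)"
    using integral_from_0_has_vector_derivative[OF assms(1)] assms(2) h
    by (intro differentiable_bound[of "{-h..h}" _ "\<lambda>s r. r *\<^sub>R f s"])
      (auto simp: has_vector_derivative_def)
  also have "\<dots> \<le> C * h"
    using order_trans[OF norm_ge_zero assms(3)[OF h]] assms(2)
    by (intro mult_left_mono) auto
  finally show ?thesis by (simp add: integral_from_0_def)
qed

lemma integral_from_0_diff:
  assumes "continuous_on {-h..h} f" "continuous_on {-h..h} g" "t \<in> {-h..h}"
  shows "integral_from_0 h f t - integral_from_0 h g t = integral_from_0 h (\<lambda>s. f s - g s) t"
proof -
  have "f integrable_on {-h..s}" "g integrable_on {-h..s}" if "s \<in> {-h..h}" for s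
    using that assms by (auto intro!: integrable_continuous_interval intro: continuous_on_subset)
  moreover have "0 \<in> {-h..h}" using assms(3) by auto
  ultimately show ?thesis using assms(3) by (simp add: integral_from_0_def integral_diff)
qed

text \<open>Picard iteration on bounded continuous functions of \<open>t\<close>, the integral operator being
  extended by constants outside \<open>[-h, h]\<close>.\<close>

lemma global_lipschitz_integral_curve:
  fixes G :: "'a::euclidean_space \<Rightarrow> 'a"
  assumes L: "L > 0" "\<And>x y. norm (G x - G y) \<le> L * norm (x - y)" and M: "\<And>x. norm (G x) \<le> M"
  obtains h \<gamma> where "h > 0" "\<gamma> 0 = x0" "continuous_on UNIV \<gamma>"
    "\<And>t. t \<in> {-h<..<h} \<Longrightarrow> (\<gamma> has_vector_derivative G (\<gamma> t)) (at t)"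
proof -
  \<comment> \<open>This length makes the contraction factor \<open>L * h\<close> equal to
    1/2.\<close>
  define h where "h = 1 / (2 * L)"
  have h: "h > 0" unfolding h_def using L(1) by simp
  have Lh: "L * h = 1 / 2" unfolding h_def using L(1) by simp
  define c where "c t = max (-h) (min h t)" for t :: real
  have c: "c t \<in> {-h..h}" for t unfolding c_def using h by auto
  have contc: "continuous_on UNIV c" unfolding c_def by (intro continuous_intros)
  have "L-lipschitz_on UNIV G" using L by (auto simp: lipschitz_on_def dist_norm)
  then have contG: "continuous_on UNIV G" by (rule lipschitz_on_continuous_on)
  have contGc: "continuous_on S (\<lambda>s. G (apply_bcontfun \<gamma> s))" for \<gamma> and S :: "real set"
    by (intro continuous_on_compose2[OF contG]) auto
  define T where "T \<gamma> t = x0 + integral_from_0 h (\<lambda>s. G (apply_bcontfun \<gamma> s)) (c t)"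
    for \<gamma> :: "real \<Rightarrow>\<^sub>C 'a" and t
  have T: "T \<gamma> \<in> bcontfun" for \<gamma>
  proof (rule bcontfun_normI)
    have "continuous_on {-h..h} (integral_from_0 h (\<lambda>s. G (apply_bcontfun \<gamma> s)))"
      unfolding continuous_on_eq_continuous_within
      using has_vector_derivative_continuous[OF integral_from_0_has_vector_derivative[OF contGc]] by blast
    then show "continuous_on UNIV (T \<gamma>)"
      unfolding T_def using c
      by (intro continuous_intros continuous_on_compose2[OF _ contc]) auto
    show "norm (T \<gamma> t) \<le> norm x0 + M * h" for t
      unfolding T_def using norm_integral_from_0_le[OF contGc c] M norm_triangle_le
      by (metis add_left_mono order_trans norm_triangle_ineq)
  qed
  have apply_T: "apply_bcontfun (Bcontfun (T \<gamma>)) = T \<gamma>" for \<gamma>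
    using T by (simp add: Bcontfun_inverse)
  have contraction: "dist (Bcontfun (T \<gamma>)) (Bcontfun (T \<delta>)) \<le> 1 / 2 * dist \<gamma> \<delta>" for \<gamma> \<delta>
  proof (rule dist_bound)
    fix t
    have "dist (T \<gamma> t) (T \<delta> t) = norm (integral_from_0 h (\<lambda>s. G (apply_bcontfun \<gamma> s) - G (apply_bcontfun \<delta> s)) (c t))"
      unfolding T_def dist_norm by (simp add: integral_from_0_diff[OF contGc contGc c, symmetric])
    also have "\<dots> \<le> (L * dist \<gamma> \<delta>) * h"
    proof (rule norm_integral_from_0_le[OF _ c])
      show "continuous_on {-h..h} (\<lambda>s. G (apply_bcontfun \<gamma> s) - G (apply_bcontfun \<delta> s))"
        by (intro continuous_intros contGc)
      show "norm (G (apply_bcontfun \<gamma> s) - G (apply_bcontfun \<delta> s)) \<le> L * dist \<gamma> \<delta>" for s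
        using L(2)[of "apply_bcontfun \<gamma> s" "apply_bcontfun \<delta> s"] dist_bounded[of \<gamma> s \<delta>] L(1)
        by (smt (verit) dist_norm mult_left_mono)
    qed
    also have "\<dots> = (L * h) * dist \<gamma> \<delta>" by simp
    finally show "dist (apply_bcontfun (Bcontfun (T \<gamma>)) t) (apply_bcontfun (Bcontfun (T \<delta>)) t) \<le> 1 / 2 * dist \<gamma> \<delta>"
      unfolding apply_T Lh .
  qed
  have "\<exists>!\<gamma>. Bcontfun (T \<gamma>) = \<gamma>"
    by (rule banach_fix_type[of "1/2"]) (use contraction in auto)
  then obtain \<gamma> where "Bcontfun (T \<gamma>) = \<gamma>" by blast
  then have \<gamma>: "apply_bcontfun \<gamma> t = x0 + integral_from_0 h (\<lambda>s. G (apply_bcontfun \<gamma> s)) (c t)" for t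
    using apply_T[of \<gamma>] T_def[of \<gamma> t] by simp
  show ?thesis
  proof
    show "h > 0" by (rule h)
    show "apply_bcontfun \<gamma> 0 = x0" by (subst \<gamma>) (use h in \<open>simp add: integral_from_0_def c_def\<close>)
    show "continuous_on UNIV (apply_bcontfun \<gamma>)" by simp
    fix t assume t: "t \<in> {-h<..<h}"
    let ?G = "\<lambda>s. G (apply_bcontfun \<gamma> s)"
    have "(integral_from_0 h ?G has_vector_derivative ?G t) (at t)"
      using integral_from_0_has_vector_derivative[OF contGc, of t h \<gamma>] t
      by (metis at_within_Icc_at atLeastAtMost_iff greaterThanLessThan_iff less_le)
    then have "((\<lambda>s. x0 + integral_from_0 h ?G s) has_vector_derivative ?G t) (at t)"
      using has_vector_derivative_add[OF has_vector_derivative_const] by fastforce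
    moreover have "x0 + integral_from_0 h ?G s = apply_bcontfun \<gamma> s" if "s \<in> {-h<..<h}" for s
      by (subst (2) \<gamma>) (use that in \<open>simp add: c_def\<close>)
    ultimately show "(apply_bcontfun \<gamma> has_vector_derivative G (apply_bcontfun \<gamma> t)) (at t)"
      using has_vector_derivative_transform_within_open[OF _ open_greaterThanLessThan t] by blast
  qed
qed

text \<open>Composing F with the nearest point projection onto a closed ball, which is 1-Lipschitz,
  yields a bounded field that is Lipschitz everywhere and equals F on the ball. By continuity its
  curve stays in the ball for a short time, and there it is a curve of F.\<close>

lemma local_integral_curve:
  fixes F :: "'a::euclidean_space \<Rightarrow> 'a"
  assumes S: "open S" "x0 \<in> S" and F: "smooth_on S F"
  obtains e \<gamma> where "e > 0" "\<gamma> 0 = x0" "\<gamma> ` {-e<..<e} \<subseteq> S"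
    "\<And>t. t \<in> {-e<..<e} \<Longrightarrow> (\<gamma> has_vector_derivative F (\<gamma> t)) (at t)"
proof -
  obtain r where r: "r > 0" "cball x0 r \<subseteq> S" using S open_contains_cball by blast
  let ?K = "cball x0 r"
  have K: "closed ?K" "convex ?K" "compact ?K" "?K \<noteq> {}" using r(1) by auto
  obtain L where L: "L > 0" "\<And>x y. x \<in> ?K \<Longrightarrow> y \<in> ?K \<Longrightarrow> norm (F x - F y) \<le> L * norm (x - y)"
    using C1_lipschitz_on_compact_convex[OF S(1) F r(2) K(3,2)] by metis
  let ?G = "\<lambda>x. F (closest_point ?K x)"
  have "continuous_on ?K F" using smooth_on_imp_continuous_on[OF F] r(2) continuous_on_subset by blast
  then have "bounded (F ` ?K)" using K(3) compact_continuous_image compact_imp_bounded by blast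
  then obtain M where M: "\<And>x. x \<in> ?K \<Longrightarrow> norm (F x) \<le> M" unfolding bounded_iff by blast
  have inK: "closest_point ?K x \<in> ?K" for x using closest_point_in_set K by blast
  have lip: "norm (?G x - ?G y) \<le> L * norm (x - y)" for x y
  proof -
    have "norm (?G x - ?G y) \<le> L * norm (closest_point ?K x - closest_point ?K y)" using L(2) inK by blast
    also have "\<dots> \<le> L * norm (x - y)"
      using closest_point_lipschitz[OF K(2,1,4)] L(1) by (intro mult_left_mono) (auto simp: dist_norm)
    finally show ?thesis .
  qed
  obtain h \<gamma> where h: "h > 0" and \<gamma>: "\<gamma> 0 = x0" "continuous_on UNIV \<gamma>"
    "\<And>t. t \<in> {-h<..<h} \<Longrightarrow> (\<gamma> has_vector_derivative ?G (\<gamma> t)) (at t)"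
    using global_lipschitz_integral_curve[of L ?G M x0] L(1) lip M inK by metis
  have "open (\<gamma> -` ball x0 r)" using \<gamma>(2) by (simp add: open_vimage)
  moreover have "0 \<in> \<gamma> -` ball x0 r" using \<gamma>(1) r(1) by simp
  ultimately obtain d where d: "d > 0" "ball 0 d \<subseteq> \<gamma> -` ball x0 r" using open_contains_ball by blast
  define e where "e = min d h"
  have inball: "\<gamma> t \<in> ball x0 r" if "t \<in> {-e<..<e}" for t
  proof -
    have "t \<in> ball 0 d" using that by (auto simp: e_def)
    then show ?thesis using d(2) by auto
  qed
  show ?thesis
  proof
    show "e > 0" using d(1) h by (simp add: e_def)
    show "\<gamma> 0 = x0" by (rule \<gamma>(1))
    show "\<gamma> ` {-e<..<e} \<subseteq> S" using inball r(2) by force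
    fix t assume t: "t \<in> {-e<..<e}"
    have "?G (\<gamma> t) = F (\<gamma> t)" using inball[OF t] by (subst closest_point_self) auto
    moreover have "t \<in> {-h<..<h}" using t by (auto simp: e_def)
    ultimately show "(\<gamma> has_vector_derivative F (\<gamma> t)) (at t)" using \<gamma>(3) by metis
  qed
qed

text \<open>Bootstrapping: the derivative \<open>F \<circ> \<gamma>\<close> is as smooth as \<open>\<gamma>\<close>.\<close>

lemma integral_curve_smooth:
  fixes F :: "'a::euclidean_space \<Rightarrow> 'a"
  assumes "open S" "smooth_on S F" "open I" "\<gamma> ` I \<subseteq> S"
    and \<gamma>: "\<And>t. t \<in> I \<Longrightarrow> (\<gamma> has_vector_derivative F (\<gamma> t)) (at t)"
  shows "smooth_on I \<gamma>"
  unfolding smooth_on_def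
proof
  fix k show "Ck_on k I \<gamma>"
  proof (induction k)
    case 0
    then show ?case
      by (auto intro!: continuous_at_imp_continuous_on has_vector_derivative_continuous[OF \<gamma>])
  next
    case (Suc k)
    have "Ck_on k I (\<lambda>t. F (\<gamma> t))"
      by (rule Ck_on_compose[OF assms(3,1,4) Suc]) (use assms(2) in \<open>simp add: smooth_on_def\<close>)
    have "Ck_on k I (\<lambda>t. v *\<^sub>R F (\<gamma> t))" for v
      by (rule Ck_on_bounded_linear[OF assms(3) bounded_linear_scaleR_right \<open>Ck_on k I (\<lambda>t. F (\<gamma> t))\<close>])
    then show ?case
      using \<gamma> unfolding has_vector_derivative_def by (rule Ck_on_SucI[OF assms(3), rotated])
  qed
qed

section \<open>Tangent vectors as derivations\<close>

lemma eventually_nhds_image: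
  assumes "isCont h x" "\<forall>\<^sub>F y in nhds (h x). P y"
  shows "\<forall>\<^sub>F z in nhds x. P (h z)"
  using assms eventually_compose_filterlim isCont_def tendsto_at_iff_tendsto_nhds by metis

section \<open>Smooth functions read in a chart\<close>

locale smooth_manifold =
  fixes A :: "('p::{t2_space,second_countable_topology}, 'n::euclidean_space) chart set"
  assumes smooth_atlas: "smooth_atlas A"
begin

lemma obtain_chart:
  obtains C where "C \<in> A" "p \<in> fst C"
  using smooth_atlas unfolding smooth_atlas_def by blast

lemma chart_homeomorphism: "C \<in> A \<Longrightarrow> homeomorphism (fst C) (snd C ` fst C) (snd C) (chart_inv C)"
  and open_chart_domain: "C \<in> A \<Longrightarrow> open (fst C)"
  and open_chart_range: "C \<in> A \<Longrightarrow> open (snd C ` fst C)"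
  using smooth_atlas unfolding smooth_atlas_def by blast+

lemma smooth_transition:
  "C \<in> A \<Longrightarrow> C' \<in> A \<Longrightarrow> smooth_on (snd C ` (fst C \<inter> fst C')) (\<lambda>z. snd C' (chart_inv C z))"
  using smooth_atlas unfolding smooth_atlas_def comp_def by blast

lemma chart_inv_chart [simp]: "C \<in> A \<Longrightarrow> x \<in> fst C \<Longrightarrow> chart_inv C (snd C x) = x"
  using homeomorphism_apply1[OF chart_homeomorphism] by blast

lemma open_chart_image:
  assumes "C \<in> A" "open W" "W \<subseteq> fst C"
  shows "open (snd C ` W)"
proof -
  have "openin (top_of_set (snd C ` fst C)) (snd C ` W)"
    by (rule homeomorphism_imp_open_map[OF chart_homeomorphism[OF assms(1)]])
      (use assms open_chart_domain in \<open>auto simp: openin_open_eq\<close>)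
  then show ?thesis using open_chart_range[OF assms(1)] openin_open_trans by blast
qed

lemma isCont_chart_inv: "C \<in> A \<Longrightarrow> p \<in> fst C \<Longrightarrow> isCont (chart_inv C) (snd C p)"
  using homeomorphism_cont2[OF chart_homeomorphism] open_chart_range
  by (metis continuous_on_eq_continuous_at image_eqI)

text \<open>Transition maps are smooth, so a single chart decides what \<open>smooth_at\<close>
  demands of every chart of the atlas.\<close>

lemma smooth_at_iff:
  assumes C: "C \<in> A" "p \<in> fst C"
  shows "smooth_at A p f \<longleftrightarrow>
    (\<exists>W. open W \<and> p \<in> W \<and> W \<subseteq> fst C \<and> smooth_on (snd C ` W) (\<lambda>z. f (chart_inv C z)))"
proof
  assume "smooth_at A p f"
  then obtain W where W: "open W" "p \<in> W" "smooth_on (snd C ` (fst C \<inter> W)) (\<lambda>z. f (chart_inv C z))"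
    unfolding smooth_at_def comp_def using C by blast
  then show "\<exists>W. open W \<and> p \<in> W \<and> W \<subseteq> fst C \<and> smooth_on (snd C ` W) (\<lambda>z. f (chart_inv C z))"
    using C open_chart_domain[OF C(1)] by (intro exI[of _ "fst C \<inter> W"]) auto
next
  assume "\<exists>W. open W \<and> p \<in> W \<and> W \<subseteq> fst C \<and> smooth_on (snd C ` W) (\<lambda>z. f (chart_inv C z))"
  then obtain W where W: "open W" "p \<in> W" "W \<subseteq> fst C" "smooth_on (snd C ` W) (\<lambda>z. f (chart_inv C z))"
    by blast
  have "smooth_on (snd C' ` (fst C' \<inter> W)) (f \<circ> chart_inv C')" if C': "C' \<in> A" for C'
  proof -
    let ?S = "snd C' ` (fst C' \<inter> W)"
    have S: "open ?S" using open_chart_image[OF C', of "fst C' \<inter> W"] open_chart_domain[OF C'] W by auto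
    have "open (snd C' ` (fst C' \<inter> fst C))" (is "open ?S'")
      by (intro open_chart_image[OF C'] open_Int open_chart_domain C C') simp
    moreover have "?S \<subseteq> ?S'" using W by auto
    ultimately have "smooth_on ?S (\<lambda>z. snd C (chart_inv C' z))"
      using smooth_on_subset[OF smooth_transition[OF C' C(1)] _ S] by blast
    then have "smooth_on ?S (\<lambda>z. f (chart_inv C (snd C (chart_inv C' z))))"
      by (rule smooth_on_compose[OF S open_chart_image[OF C(1) W(1,3)] _ _ W(4), rotated]) (use C' in auto)
    then show ?thesis
      by (subst smooth_on_cong[OF S]) (use C C' W(3) in auto)
  qed
  then show "smooth_at A p f" unfolding smooth_at_def using W by blast
qed

lemma smooth_at_obtain_common:
  assumes C: "C \<in> A" "p \<in> fst C" and "smooth_at A p f" "smooth_at A p g"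
  obtains W where "open W" "p \<in> W" "W \<subseteq> fst C" "open (snd C ` W)"
    "smooth_on (snd C ` W) (\<lambda>z. f (chart_inv C z))" "smooth_on (snd C ` W) (\<lambda>z. g (chart_inv C z))"
proof -
  obtain W where W: "open W" "p \<in> W" "W \<subseteq> fst C" "smooth_on (snd C ` W) (\<lambda>z. f (chart_inv C z))"
    using assms(3) smooth_at_iff[OF C] by blast
  obtain U where U: "open U" "p \<in> U" "U \<subseteq> fst C" "smooth_on (snd C ` U) (\<lambda>z. g (chart_inv C z))"
    using assms(4) smooth_at_iff[OF C] by blast
  have o: "open (snd C ` (W \<inter> U))" "open (snd C ` W)" "open (snd C ` U)"
    using W U by (auto intro!: open_chart_image[OF C(1)])
  show ?thesis
    by (rule that[of "W \<inter> U"])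
      (use W U o in \<open>auto intro: smooth_on_subset[OF W(4)] smooth_on_subset[OF U(4)]\<close>)
qed

lemma eventually_smooth_at: "smooth_at A p f \<Longrightarrow> \<forall>\<^sub>F x in nhds p. smooth_at A x f"
  unfolding smooth_at_def eventually_nhds by blast

lemma smooth_at_cong:
  assumes "smooth_at A p f" "\<forall>\<^sub>F x in nhds p. f x = g x"
  shows "smooth_at A p g"
proof -
  obtain C where C: "C \<in> A" "p \<in> fst C" by (rule obtain_chart)
  obtain W where W: "open W" "p \<in> W" "W \<subseteq> fst C" "smooth_on (snd C ` W) (\<lambda>z. f (chart_inv C z))"
    using assms(1) smooth_at_iff[OF C] by blast
  obtain U where U: "open U" "p \<in> U" "\<And>x. x \<in> U \<Longrightarrow> f x = g x"
    using assms(2) unfolding eventually_nhds by blast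
  have o: "open (snd C ` (W \<inter> U))" "open (snd C ` W)" using W U by (auto intro!: open_chart_image[OF C(1)])
  have "smooth_on (snd C ` (W \<inter> U)) (\<lambda>z. f (chart_inv C z))"
    using smooth_on_subset[OF W(4) _ o] by blast
  then have "smooth_on (snd C ` (W \<inter> U)) (\<lambda>z. g (chart_inv C z))"
    by (subst (asm) smooth_on_cong[OF o(1), where g = "\<lambda>z. g (chart_inv C z)"]) (use W U C in auto)
  then show ?thesis using smooth_at_iff[OF C] W U by blast
qed

lemma smooth_at_const: "smooth_at A p (\<lambda>x. c)"
proof -
  obtain C where C: "C \<in> A" "p \<in> fst C" by (rule obtain_chart)
  then show ?thesis
    unfolding smooth_at_iff[OF C] using open_chart_domain[OF C(1)] open_chart_range[OF C(1)] smooth_on_const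
    by blast
qed

lemma smooth_at_add: "smooth_at A p f \<Longrightarrow> smooth_at A p g \<Longrightarrow> smooth_at A p (\<lambda>x. f x + g x)"
  and smooth_at_mult: "smooth_at A p f \<Longrightarrow> smooth_at A p g \<Longrightarrow> smooth_at A p (\<lambda>x. f x * g x)"
proof -
  assume fg: "smooth_at A p f" "smooth_at A p g"
  obtain C where C: "C \<in> A" "p \<in> fst C" by (rule obtain_chart)
  obtain W where W: "open W" "p \<in> W" "W \<subseteq> fst C" "open (snd C ` W)"
    "smooth_on (snd C ` W) (\<lambda>z. f (chart_inv C z))" "smooth_on (snd C ` W) (\<lambda>z. g (chart_inv C z))"
    using smooth_at_obtain_common[OF C fg] by blast
  show "smooth_at A p (\<lambda>x. f x + g x)"
    unfolding smooth_at_iff[OF C] using W smooth_on_add[OF W(4-6)] by blast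
  show "smooth_at A p (\<lambda>x. f x * g x)"
    unfolding smooth_at_iff[OF C] using W smooth_on_scaleR[OF W(4-6)] by auto
qed

lemma smooth_at_sum:
  "(\<And>b. b \<in> I \<Longrightarrow> smooth_at A p (f b)) \<Longrightarrow> smooth_at A p (\<lambda>x. \<Sum>b\<in>I. f b x)"
  by (induction I rule: infinite_finite_induct) (auto intro: smooth_at_const smooth_at_add)

lemma smooth_at_coord:
  assumes C: "C \<in> A" "p \<in> fst C"
  shows "smooth_at A p (\<lambda>x. snd C x \<bullet> b)"
proof -
  have o: "open (snd C ` fst C)" by (rule open_chart_range[OF C(1)])
  have "smooth_on (snd C ` fst C) (\<lambda>z. z \<bullet> b)"
    by (intro smooth_on_bounded_linear[OF o bounded_linear_inner_left] smooth_on_id o)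
  then have "smooth_on (snd C ` fst C) (\<lambda>z. snd C (chart_inv C z) \<bullet> b)"
    by (subst smooth_on_cong[OF o, where g = "\<lambda>z. z \<bullet> b"]) (use C in auto)
  then show ?thesis unfolding smooth_at_iff[OF C] using C open_chart_domain by blast
qed

section \<open>Coordinate vectors and the rules for derivations\<close>

lemma smooth_at_has_derivative:
  assumes C: "C \<in> A" "p \<in> fst C" and f: "smooth_at A p f"
  shows "((\<lambda>z. f (chart_inv C z)) has_derivative (\<lambda>u. coord_vec A C p u f)) (at (snd C p))"
proof -
  obtain W where W: "open W" "p \<in> W" "W \<subseteq> fst C" "smooth_on (snd C ` W) (\<lambda>z. f (chart_inv C z))"
    using f smooth_at_iff[OF C] by blast
  show ?thesis
    using smooth_on_has_derivative[OF W(4) open_chart_image[OF C(1) W(1,3)], of "snd C p"] W(2) f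
    by (simp add: coord_vec_def comp_def)
qed

text \<open>Uniqueness of the derivative reduces rules for tangent vectors to rules for
  \<open>has_derivative\<close> in a chart.\<close>

lemma coord_vec_eqI:
  assumes C: "C \<in> A" "p \<in> fst C" and f: "smooth_at A p f"
    and "((\<lambda>z. f (chart_inv C z)) has_derivative f') (at (snd C p))"
  shows "coord_vec A C p u f = f' u"
  using has_derivative_unique[OF smooth_at_has_derivative[OF C f] assms(4)] by metis

lemma coord_vec_not_smooth: "\<not> smooth_at A p f \<Longrightarrow> coord_vec A C p u f = 0"
  by (simp add: coord_vec_def)

lemma linear_coord_vec:
  assumes C: "C \<in> A" "p \<in> fst C"
  shows "linear (coord_vec A C p)"
proof (rule linearI)
  show "coord_vec A C p (u + v) = coord_vec A C p u + coord_vec A C p v" for u v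
  proof
    fix f show "coord_vec A C p (u + v) f = (coord_vec A C p u + coord_vec A C p v) f"
      using linear_add[OF has_derivative_linear[OF smooth_at_has_derivative[OF C, of f]]]
      by (cases "smooth_at A p f") (auto simp: coord_vec_not_smooth)
  qed
  show "coord_vec A C p (r *\<^sub>R u) = r *\<^sub>R coord_vec A C p u" for r u
  proof
    fix f show "coord_vec A C p (r *\<^sub>R u) f = (r *\<^sub>R coord_vec A C p u) f"
      using linear_scale[OF has_derivative_linear[OF smooth_at_has_derivative[OF C, of f]]]
      by (cases "smooth_at A p f") (auto simp: coord_vec_not_smooth)
  qed
qed

lemma coord_vec_in_tangent_space: "C \<in> A \<Longrightarrow> p \<in> fst C \<Longrightarrow> coord_vec A C p u \<in> tangent_space A p"
  unfolding tangent_space_def by blast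

lemma smooth_at_coord_vec:
  assumes C: "C \<in> A" "p \<in> fst C" and f: "smooth_at A p f"
  shows "smooth_at A p (\<lambda>x. coord_vec A C x u f)"
proof -
  obtain W where W: "open W" "p \<in> W" "W \<subseteq> fst C" "smooth_on (snd C ` W) (\<lambda>z. f (chart_inv C z))"
    using f smooth_at_iff[OF C] by blast
  let ?D = "\<lambda>z. frechet_derivative (\<lambda>z. f (chart_inv C z)) (at z) u"
  have o: "open (snd C ` W)" using open_chart_image[OF C(1)] W by blast
  have "smooth_on (snd C ` W) ?D" using smooth_on_frechet_derivative[OF W(4)] .
  moreover have "coord_vec A C (chart_inv C z) u f = ?D z" if "z \<in> snd C ` W" for z
  proof -
    \<comment> \<open>The default value 0 of \<open>coord_vec\<close> must not interfere: f is
      smooth at every point of W, not merely at p.\<close>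
    have "smooth_at A x f" if "x \<in> W" for x using smooth_at_iff[of C x f] C W that by blast
    then show ?thesis using that W C by (auto simp: coord_vec_def comp_def subset_eq)
  qed
  ultimately have "smooth_on (snd C ` W) (\<lambda>z. coord_vec A C (chart_inv C z) u f)"
    by (subst smooth_on_cong[OF o]) auto
  then show ?thesis unfolding smooth_at_iff[OF C] using W by blast
qed

lemma coord_vec_commute:
  assumes C: "C \<in> A" "p \<in> fst C" and f: "smooth_at A p f"
  shows "coord_vec A C p v (\<lambda>x. coord_vec A C x u f) = coord_vec A C p u (\<lambda>x. coord_vec A C x v f)"
proof -
  obtain W where W: "open W" "p \<in> W" "W \<subseteq> fst C" "smooth_on (snd C ` W) (\<lambda>z. f (chart_inv C z))"
    using f smooth_at_iff[OF C] by blast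
  let ?D = "\<lambda>u z. frechet_derivative (\<lambda>z. f (chart_inv C z)) (at z) u"
  have o: "open (snd C ` W)" using open_chart_image[OF C(1)] W by blast
  have z: "snd C p \<in> snd C ` W" using W by blast
  have eq: "coord_vec A C (chart_inv C z) u f = ?D u z" if "z \<in> snd C ` W" for z u
  proof -
    have "smooth_at A x f" if "x \<in> W" for x using smooth_at_iff[of C x f] C W that by blast
    then show ?thesis using that W C by (auto simp: coord_vec_def comp_def subset_eq)
  qed
  have "coord_vec A C p v (\<lambda>x. coord_vec A C x u f) = frechet_derivative (?D u) (at (snd C p)) v" for u v
  proof (rule coord_vec_eqI[OF C smooth_at_coord_vec[OF C f]])
    have "(?D u has_derivative frechet_derivative (?D u) (at (snd C p))) (at (snd C p))"
      using smooth_on_has_derivative[OF smooth_on_frechet_derivative[OF W(4)] o z] .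
    then show "((\<lambda>z. coord_vec A C (chart_inv C z) u f) has_derivative
        frechet_derivative (?D u) (at (snd C p))) (at (snd C p))"
      by (rule has_derivative_transform_within_open[OF _ o z]) (simp add: eq)
  qed
  then show ?thesis using symmetric_second_derivative[OF W(4) o z] by simp
qed

lemma tangent_vector_not_smooth: "v \<in> tangent_space A p \<Longrightarrow> \<not> smooth_at A p f \<Longrightarrow> v f = 0"
  unfolding tangent_space_def by (auto simp: coord_vec_def)

text \<open>A tangent vector depends on the germ only, so identities that hold merely near p may be
  differentiated. Functions with the same germ are both smooth or both not, so the default value is
  respected.\<close>

lemma tangent_vector_cong:
  assumes "v \<in> tangent_space A p" "\<forall>\<^sub>F x in nhds p. f x = g x"
  shows "v f = v g"
proof -
  have sg: "smooth_at A p f \<longleftrightarrow> smooth_at A p g"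
    using smooth_at_cong[of p f g] smooth_at_cong[of p g f] assms(2) by (auto simp: eq_commute)
  obtain C u where C: "C \<in> A" "p \<in> fst C" and v: "v = coord_vec A C p u"
    using assms(1) unfolding tangent_space_def by blast
  show ?thesis
  proof (cases "smooth_at A p f")
    case True
    have "\<forall>\<^sub>F z in nhds (snd C p). f (chart_inv C z) = g (chart_inv C z)"
      using eventually_nhds_image[OF isCont_chart_inv[OF C]] assms(2) C by simp
    then have "((\<lambda>z. g (chart_inv C z)) has_derivative (\<lambda>u. coord_vec A C p u f)) (at (snd C p))"
      using has_derivative_transform_eventually[OF smooth_at_has_derivative[OF C True]]
      by (simp add: eventually_nhds_conv_at)
    then show ?thesis using coord_vec_eqI[OF C] True sg v by metis
  next
    case False
    then show ?thesis using sg v by (simp add: coord_vec_not_smooth)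
  qed
qed

lemma tangent_vector_const: "v \<in> tangent_space A p \<Longrightarrow> v (\<lambda>x. c) = 0"
  unfolding tangent_space_def using coord_vec_eqI[OF _ _ smooth_at_const has_derivative_const] by auto

lemma tangent_vector_add:
  assumes "v \<in> tangent_space A p" "smooth_at A p f" "smooth_at A p g"
  shows "v (\<lambda>x. f x + g x) = v f + v g"
proof -
  obtain C u where C: "C \<in> A" "p \<in> fst C" and v: "v = coord_vec A C p u"
    using assms(1) unfolding tangent_space_def by blast
  show ?thesis unfolding v
    by (rule coord_vec_eqI[OF C smooth_at_add[OF assms(2,3)]])
      (intro has_derivative_add smooth_at_has_derivative C assms)
qed

lemma tangent_vector_mult:
  assumes "v \<in> tangent_space A p" "smooth_at A p f" "smooth_at A p g"
  shows "v (\<lambda>x. f x * g x) = v f * g p + f p * v g"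
proof -
  obtain C u where C: "C \<in> A" "p \<in> fst C" and v: "v = coord_vec A C p u"
    using assms(1) unfolding tangent_space_def by blast
  show ?thesis unfolding v
    using coord_vec_eqI[OF C smooth_at_mult[OF assms(2,3)]
        has_derivative_mult[OF smooth_at_has_derivative[OF C assms(2)] smooth_at_has_derivative[OF C assms(3)]], of u] C
    by simp
qed

lemma tangent_vector_sum:
  assumes "v \<in> tangent_space A p" "finite I" "\<And>b. b \<in> I \<Longrightarrow> smooth_at A p (f b)"
  shows "v (\<lambda>x. \<Sum>b\<in>I. f b x) = (\<Sum>b\<in>I. v (f b))"
  using assms(2,3)
proof (induction I rule: finite_induct)
  case empty
  then show ?case using tangent_vector_const[OF assms(1)] by simp
next
  case (insert b I)
  then show ?case using tangent_vector_add[OF assms(1) _ smooth_at_sum[of I p f]] by simp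
qed

end

text \<open>With \<open>i = id\<close> this is the expansion of a tangent vector in the coordinate frame.\<close>

lemma (in smooth_manifold) tangent_vector_chain_rule:
  fixes B :: "('q::{t2_space,second_countable_topology}, 'm::euclidean_space) chart set"
  assumes "smooth_atlas B" and v: "v \<in> tangent_space B q" and i: "smooth_map_at B A i q"
    and C: "C \<in> A" "i q \<in> fst C" and f: "smooth_at A (i q) f"
  shows "v (\<lambda>y. f (i y)) = (\<Sum>b\<in>Basis. v (\<lambda>y. snd C (i y) \<bullet> b) * coord_vec A C (i q) b f)"
proof -
  interpret B: smooth_manifold B by unfold_locales (rule assms(1))
  obtain C' u where C': "C' \<in> B" "q \<in> fst C'" and vu: "v = coord_vec B C' q u"
    using v unfolding tangent_space_def by blast
  have smooth_i: "smooth_at B q (\<lambda>y. h (i y))" if "smooth_at A (i q) h" for h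
    using i that unfolding smooth_map_at_def comp_def by blast
  let ?d = "\<lambda>u. \<Sum>b\<in>Basis. coord_vec B C' q u (\<lambda>y. snd C (i y) \<bullet> b) *\<^sub>R b"
  have "((\<lambda>z. \<Sum>b\<in>Basis. (snd C (i (chart_inv C' z)) \<bullet> b) *\<^sub>R b) has_derivative ?d) (at (snd C' q))"
    by (intro has_derivative_sum has_derivative_scaleR_left
        B.smooth_at_has_derivative[OF C' smooth_i[OF smooth_at_coord[OF C]]])
  then have d: "((\<lambda>z. snd C (i (chart_inv C' z))) has_derivative ?d) (at (snd C' q))"
    by (simp add: euclidean_representation)
  have f': "((\<lambda>z. f (chart_inv C z)) has_derivative (\<lambda>u. coord_vec A C (i q) u f))
      (at (snd C (i (chart_inv C' (snd C' q)))))"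
    using smooth_at_has_derivative[OF C f] C' by simp
  \<comment> \<open>Inserting the chart and its inverse between f and i changes nothing only while i
    stays in the chart domain, which continuity ensures near q.\<close>
  have "\<forall>\<^sub>F y in nhds (i q). y \<in> fst C"
    using C open_chart_domain eventually_nhds_in_open by blast
  then have "\<forall>\<^sub>F y in nhds q. i y \<in> fst C"
    using eventually_nhds_image i unfolding smooth_map_at_def by blast
  then have "\<forall>\<^sub>F z in nhds (snd C' q). i (chart_inv C' z) \<in> fst C"
    using eventually_nhds_image[OF B.isCont_chart_inv[OF C'], of "\<lambda>y. i y \<in> fst C"] C' by simp
  then have "\<forall>\<^sub>F z in nhds (snd C' q).
      f (chart_inv C (snd C (i (chart_inv C' z)))) = f (i (chart_inv C' z))"
    by eventually_elim (use C in simp)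
  then have "((\<lambda>z. f (i (chart_inv C' z))) has_derivative (\<lambda>u. coord_vec A C (i q) (?d u) f)) (at (snd C' q))"
    using has_derivative_transform_eventually[OF has_derivative_compose[OF d f']] C C'
    by (simp add: eventually_nhds_conv_at)
  then have "v (\<lambda>y. f (i y)) = coord_vec A C (i q) (?d u) f"
    unfolding vu by (rule B.coord_vec_eqI[OF C' smooth_i[OF f]])
  also have "\<dots> = (\<Sum>b\<in>Basis. (?d u \<bullet> b) * coord_vec A C (i q) b f)"
    using has_derivative_Basis_sum[OF smooth_at_has_derivative[OF C f], of "?d u"]
    by (simp only: real_scaleR_def)
  also have "\<dots> = (\<Sum>b\<in>Basis. v (\<lambda>y. snd C (i y) \<bullet> b) * coord_vec A C (i q) b f)"
    unfolding vu by (intro sum.cong refl) simp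
  finally show ?thesis .
qed

section \<open>Coordinate frames, pushforwards, smooth fields and brackets\<close>

context smooth_manifold
begin

lemma smooth_map_at_ident: "smooth_map_at A A (\<lambda>x. x) p"
  by (simp add: smooth_map_at_def comp_def)

lemma tangent_vector_coord_frame:
  assumes "v \<in> tangent_space A p" "C \<in> A" "p \<in> fst C" "smooth_at A p f"
  shows "v f = (\<Sum>b\<in>Basis. v (\<lambda>x. snd C x \<bullet> b) * coord_vec A C p b f)"
  using tangent_vector_chain_rule[OF smooth_atlas assms(1) smooth_map_at_ident assms(2-4)] .

text \<open>Tangent vectors are total functions, so the value 0 on functions that are not smooth has
  to be checked separately.\<close>

lemma eq_coord_vecI:
  assumes C: "C \<in> A" "p \<in> fst C"
    and "\<And>f. smooth_at A p f \<Longrightarrow> v f = (\<Sum>b\<in>Basis. c b * coord_vec A C p b f)"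
    and "\<And>f. \<not> smooth_at A p f \<Longrightarrow> v f = 0"
  shows "v = coord_vec A C p (\<Sum>b\<in>Basis. c b *\<^sub>R b)"
proof
  fix f
  have lin: "linear (\<lambda>u. coord_vec A C p u f)" if "smooth_at A p f"
    using has_derivative_linear[OF smooth_at_has_derivative[OF C that]] .
  show "v f = coord_vec A C p (\<Sum>b\<in>Basis. c b *\<^sub>R b) f"
  proof (cases "smooth_at A p f")
    case True
    show ?thesis
      by (simp add: assms(3)[OF True] linear_sum[OF lin[OF True]] linear_scale[OF lin[OF True]])
  next
    case False
    then show ?thesis by (simp add: assms(4) coord_vec_not_smooth)
  qed
qed

lemma tangent_vector_eq_coord_vec:
  assumes "v \<in> tangent_space A p" "C \<in> A" "p \<in> fst C"
  shows "v = coord_vec A C p (\<Sum>b\<in>Basis. v (\<lambda>x. snd C x \<bullet> b) *\<^sub>R b)"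
  by (rule eq_coord_vecI) (use assms tangent_vector_coord_frame tangent_vector_not_smooth in auto)

lemma tangent_vector_eq_sum:
  assumes "v \<in> tangent_space A p" "C \<in> A" "p \<in> fst C"
  shows "v = (\<Sum>b\<in>Basis. v (\<lambda>x. snd C x \<bullet> b) *\<^sub>R coord_vec A C p b)"
proof -
  note lin = linear_coord_vec[OF assms(2,3)]
  have "coord_vec A C p (\<Sum>b\<in>Basis. v (\<lambda>x. snd C x \<bullet> b) *\<^sub>R b)
      = (\<Sum>b\<in>Basis. v (\<lambda>x. snd C x \<bullet> b) *\<^sub>R coord_vec A C p b)"
    by (simp only: linear_sum[OF lin] linear_scale[OF lin])
  then show ?thesis using tangent_vector_eq_coord_vec[OF assms] by simp
qed

lemma tangent_space_eq_range:
  assumes "C \<in> A" "p \<in> fst C"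
  shows "tangent_space A p = range (coord_vec A C p)"
  using tangent_vector_eq_coord_vec[OF _ assms] coord_vec_in_tangent_space[OF assms] by blast

lemma subspace_tangent_space: "subspace (tangent_space A p)"
proof -
  obtain C where C: "C \<in> A" "p \<in> fst C" by (rule obtain_chart)
  show ?thesis
    unfolding tangent_space_eq_range[OF C]
    by (rule linear_subspace_image[OF linear_coord_vec[OF C] subspace_UNIV])
qed

lemma pushforward_in_tangent_space:
  fixes B :: "('q::{t2_space,second_countable_topology}, 'm::euclidean_space) chart set"
  assumes "smooth_atlas B" "v \<in> tangent_space B q" "smooth_map_at B A i q"
  shows "pushforward A i q v \<in> tangent_space A (i q)"
proof -
  obtain C where C: "C \<in> A" "i q \<in> fst C" by (rule obtain_chart)
  have "pushforward A i q v = coord_vec A C (i q) (\<Sum>b\<in>Basis. v (\<lambda>y. snd C (i y) \<bullet> b) *\<^sub>R b)"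
    by (rule eq_coord_vecI[OF C])
      (use tangent_vector_chain_rule[OF assms C] in \<open>auto simp: pushforward_def comp_def\<close>)
  then show ?thesis using coord_vec_in_tangent_space[OF C] by simp
qed

lemma smooth_field_atD:
  assumes "smooth_field_at A p X"
  shows "\<forall>\<^sub>F x in nhds p. X x \<in> tangent_space A x" "X p \<in> tangent_space A p"
    and "smooth_at A p f \<Longrightarrow> smooth_at A p (\<lambda>x. X x f)"
  using assms eventually_nhds_x_imp_x
  unfolding smooth_field_at_def smooth_field_along_at_def by blast+

lemma smooth_field_at_coord_vec:
  assumes C: "C \<in> A" "p \<in> fst C"
  shows "smooth_field_at A p (\<lambda>x. coord_vec A C x u)"
proof -
  have "\<forall>\<^sub>F x in nhds p. x \<in> fst C" using C open_chart_domain eventually_nhds_in_open by blast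
  then have "\<forall>\<^sub>F x in nhds p. coord_vec A C x u \<in> tangent_space A x"
    by eventually_elim (rule coord_vec_in_tangent_space[OF C(1)])
  then show ?thesis
    unfolding smooth_field_at_def smooth_field_along_at_def using smooth_at_coord_vec[OF C] by blast
qed

text \<open>In coordinates, \<open>X (Y f) - Y (X f)\<close> loses its second order part by the symmetry of second
  derivatives.\<close>

lemma lie_bracket_in_tangent_space:
  assumes X: "smooth_field_at A p X" and Y: "smooth_field_at A p Y"
  shows "lie_bracket A X Y p \<in> tangent_space A p"
proof -
  obtain C where C: "C \<in> A" "p \<in> fst C" by (rule obtain_chart)
  let ?x = "\<lambda>b x. snd C x \<bullet> b" and ?d = "\<lambda>b x. coord_vec A C x b"
  \<comment> \<open>Proved for arbitrary fields, to be used for (X, Y) and for (Y, X). The single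
    sum is of first order in f, the double sum of second order.\<close>
  have second: "X p (\<lambda>x. Y x f) = (\<Sum>b\<in>Basis. X p (\<lambda>x. Y x (?x b)) * ?d b p f)
      + (\<Sum>b\<in>Basis. \<Sum>c\<in>Basis. Y p (?x b) * (X p (?x c) * ?d c p (\<lambda>x. ?d b x f)))"
    if X: "smooth_field_at A p X" and Y: "smooth_field_at A p Y" and f: "smooth_at A p f" for X Y f
  proof -
    note Xp = smooth_field_atD(2)[OF X]
    have "\<forall>\<^sub>F x in nhds p. x \<in> fst C" using C open_chart_domain eventually_nhds_in_open by blast
    then have "\<forall>\<^sub>F x in nhds p. Y x f = (\<Sum>b\<in>Basis. Y x (?x b) * ?d b x f)"
      using eventually_smooth_at[OF f] smooth_field_atD(1)[OF Y]
      by eventually_elim (rule tangent_vector_coord_frame[OF _ C(1)])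
    then have "X p (\<lambda>x. Y x f) = X p (\<lambda>x. \<Sum>b\<in>Basis. Y x (?x b) * ?d b x f)"
      by (rule tangent_vector_cong[OF Xp])
    also have "\<dots> = (\<Sum>b\<in>Basis. X p (\<lambda>x. Y x (?x b) * ?d b x f))"
      by (intro tangent_vector_sum[OF Xp] smooth_at_mult smooth_field_atD(3)[OF Y] smooth_at_coord
          smooth_at_coord_vec C f) simp
    also have "\<dots> = (\<Sum>b\<in>Basis. X p (\<lambda>x. Y x (?x b)) * ?d b p f + Y p (?x b) * X p (\<lambda>x. ?d b x f))"
      by (intro sum.cong refl tangent_vector_mult[OF Xp] smooth_field_atD(3)[OF Y] smooth_at_coord
          smooth_at_coord_vec C f)
    also have "\<dots> = (\<Sum>b\<in>Basis. X p (\<lambda>x. Y x (?x b)) * ?d b p f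
        + Y p (?x b) * (\<Sum>c\<in>Basis. X p (?x c) * ?d c p (\<lambda>x. ?d b x f)))"
      using tangent_vector_coord_frame[OF Xp C smooth_at_coord_vec[OF C f]] by simp
    finally show ?thesis by (simp add: sum.distrib sum_distrib_left)
  qed
  have "lie_bracket A X Y p f = (\<Sum>b\<in>Basis. (X p (\<lambda>x. Y x (?x b)) - Y p (\<lambda>x. X x (?x b))) * ?d b p f)"
    if f: "smooth_at A p f" for f
  proof -
    \<comment> \<open>Swapping the indices and commuting the coordinate derivatives identifies the
      two second order parts, which cancel in the bracket.\<close>
    have "(\<Sum>b\<in>Basis. \<Sum>c\<in>Basis. Y p (?x b) * (X p (?x c) * ?d c p (\<lambda>x. ?d b x f)))
        = (\<Sum>b\<in>Basis. \<Sum>c\<in>Basis. X p (?x b) * (Y p (?x c) * ?d c p (\<lambda>x. ?d b x f)))"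
      by (subst sum.swap) (simp add: coord_vec_commute[OF C f] mult.left_commute)
    then show ?thesis
      using f second[OF X Y f] second[OF Y X f]
      by (simp add: lie_bracket_def left_diff_distrib sum_subtractf)
  qed
  then have "lie_bracket A X Y p
      = coord_vec A C p (\<Sum>b\<in>Basis. (X p (\<lambda>x. Y x (?x b)) - Y p (\<lambda>x. X x (?x b))) *\<^sub>R b)"
    by (rule eq_coord_vecI[OF C]) (simp_all add: lie_bracket_def)
  then show ?thesis using coord_vec_in_tangent_space[OF C] by simp
qed

end

section \<open>Line fields have integral manifolds\<close>

lemma chart_inv_UNIV_id: "chart_inv (UNIV, id) = (\<lambda>x. x)"
  by (auto simp: chart_inv_def)

lemma smooth_manifold_euclidean_atlas:
  "smooth_manifold (euclidean_atlas :: ('e::euclidean_space, 'e) chart set)"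
proof
  have "homeomorphism UNIV UNIV (\<lambda>x::'e. x) (\<lambda>x. x)" by (simp add: homeomorphism_def)
  then show "smooth_atlas (euclidean_atlas :: ('e, 'e) chart set)"
    unfolding smooth_atlas_def euclidean_atlas_def
    by (simp add: chart_inv_UNIV_id comp_def flip: id_def) (simp add: id_def smooth_on_id)
qed

context smooth_manifold
begin

lemma smooth_on_chart_range:
  assumes C: "C \<in> A" and f: "\<And>p. p \<in> fst C \<Longrightarrow> smooth_at A p f"
  shows "smooth_on (snd C ` fst C) (\<lambda>z. f (chart_inv C z))"
proof (rule smooth_on_local[OF open_chart_range[OF C]])
  fix z assume "z \<in> snd C ` fst C"
  then obtain p where p: "p \<in> fst C" "z = snd C p" by blast
  then obtain W where "open W" "p \<in> W" "W \<subseteq> fst C" "smooth_on (snd C ` W) (\<lambda>z. f (chart_inv C z))"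
    using f smooth_at_iff[OF C p(1)] by blast
  then show "\<exists>U. open U \<and> z \<in> U \<and> smooth_on U (\<lambda>z. f (chart_inv C z))"
    using open_chart_image[OF C] p(2) by blast
qed

text \<open>The integral manifolds are the integral curves of \<open>X\<close>, parametrized by the coordinate
  \<open>s \<bullet> u\<close> of the model space along a fixed unit vector \<open>u\<close>.\<close>

lemma integrable_line_distribution:
  fixes X :: "'p \<Rightarrow> 'p tvec"
  assumes X: "\<And>p. smooth_field_at A p X" and nz: "\<And>p. X p \<noteq> 0" and D: "\<And>p. D p = span {X p}"
  shows "integrable_distribution A D"
  unfolding integrable_distribution_def
proof
  fix q
  interpret E: smooth_manifold "euclidean_atlas :: ('n, 'n) chart set"
    by (rule smooth_manifold_euclidean_atlas)
  have id_chart: "(UNIV, id) \<in> (euclidean_atlas :: ('n, 'n) chart set)" by (simp add: euclidean_atlas_def)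
  obtain C where C: "C \<in> A" "q \<in> fst C" by (rule obtain_chart)
  let ?S = "snd C ` fst C"
  have oS: "open ?S" by (rule open_chart_range[OF C(1)])
  \<comment> \<open>The components of X in the chart C, a vector field on an open set of the model
    space.\<close>
  define F where "F z = (\<Sum>b\<in>Basis. X (chart_inv C z) (\<lambda>x. snd C x \<bullet> b) *\<^sub>R b)" for z
  have F: "smooth_on ?S F"
    unfolding F_def
    by (intro smooth_on_sum smooth_on_scaleR smooth_on_const oS
        smooth_on_chart_range[OF C(1)] smooth_field_atD(3)[OF X] smooth_at_coord[OF C(1)])
  have XF: "X (chart_inv C z) = coord_vec A C (chart_inv C z) (F z)" if "z \<in> ?S" for z
    unfolding F_def using that C
    by (intro tangent_vector_eq_coord_vec smooth_field_atD(2)[OF X]) auto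
  obtain e \<gamma> where e: "e > 0" and \<gamma>: "\<gamma> 0 = snd C q" "\<gamma> ` {-e<..<e} \<subseteq> ?S"
    "\<And>t. t \<in> {-e<..<e} \<Longrightarrow> (\<gamma> has_vector_derivative F (\<gamma> t)) (at t)"
    using local_integral_curve[OF oS _ F, of "snd C q"] C by blast
  have smooth_\<gamma>: "smooth_on {-e<..<e} \<gamma>"
    by (rule integral_curve_smooth[OF oS F open_greaterThanLessThan \<gamma>(2,3)])
  \<comment> \<open>An integral manifold is parametrized from the model space. The curve is extended
    as a constant in the directions orthogonal to u, and W is the slab on which it is defined;
    injectivity is asked only on the line spanned by u.\<close>
  obtain u :: 'n where u: "u \<in> Basis" using nonempty_Basis by blast
  define W where "W = {s :: 'n. s \<bullet> u \<in> {-e<..<e}}"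
  have oW: "open W"
    unfolding W_def using open_vimage[OF open_greaterThanLessThan, of "\<lambda>s. s \<bullet> u" "-e" e]
    by (simp add: vimage_def continuous_on_inner)
  define c where "c s = \<gamma> (s \<bullet> u)" for s
  have c_S: "c s \<in> ?S" if "s \<in> W" for s using that \<gamma>(2) by (auto simp: W_def c_def)
  have smooth_c: "smooth_on W c"
    unfolding c_def
    by (rule smooth_on_compose[OF oW open_greaterThanLessThan _
          smooth_on_bounded_linear[OF oW bounded_linear_inner_left smooth_on_id[OF oW]] smooth_\<gamma>])
      (auto simp: W_def)
  have c_der: "(c has_derivative (\<lambda>h. (h \<bullet> u) *\<^sub>R F (c s))) (at s)" if "s \<in> W" for s
    unfolding c_def
    by (rule has_derivative_compose[where f = "\<lambda>s. s \<bullet> u" and x = s,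
          OF bounded_linear.has_derivative[OF bounded_linear_inner_left has_derivative_ident]
            \<gamma>(3)[unfolded has_vector_derivative_def]])
      (use that in \<open>auto simp: W_def\<close>)
  define \<sigma> where "\<sigma> s = chart_inv C (c s)" for s
  have \<sigma>_dom: "\<sigma> s \<in> fst C" and c_\<sigma>: "c s = snd C (\<sigma> s)" if "s \<in> W" for s
    using c_S[OF that] C by (auto simp: \<sigma>_def)
  have smooth_\<sigma>: "smooth_map_at euclidean_atlas A \<sigma> s" if s: "s \<in> W" for s
    unfolding smooth_map_at_def
  proof (intro conjI allI impI)
    have "isCont c s" using c_der[OF s] has_derivative_continuous by blast
    then show "isCont \<sigma> s"
      unfolding \<sigma>_def
      using isCont_o2[of s c "chart_inv C"] isCont_chart_inv[OF C(1) \<sigma>_dom[OF s]] c_\<sigma>[OF s] by simp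
    fix f assume "smooth_at A (\<sigma> s) f"
    then obtain V where V: "open V" "\<sigma> s \<in> V" "V \<subseteq> fst C" "smooth_on (snd C ` V) (\<lambda>z. f (chart_inv C z))"
      using smooth_at_iff[OF C(1) \<sigma>_dom[OF s]] by blast
    have oV: "open (snd C ` V)" by (rule open_chart_image[OF C(1) V(1,3)])
    let ?U = "W \<inter> c -` (snd C ` V)"
    have oU: "open ?U"
      using continuous_open_preimage[OF smooth_on_imp_continuous_on[OF smooth_c] oW oV] .
    have sU: "s \<in> ?U" using s V(2) c_\<sigma>[OF s] by auto
    have "smooth_on ?U (\<lambda>s. f (chart_inv C (c s)))"
      by (rule smooth_on_compose[OF oU oV _ _ V(4)]) (use smooth_on_subset[OF smooth_c _ oU oW] in auto)
    then show "smooth_at euclidean_atlas s (f \<circ> \<sigma>)"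
      unfolding E.smooth_at_iff[OF id_chart, of s, simplified]
      using oU sU by (auto simp: chart_inv_UNIV_id \<sigma>_def comp_def)
  qed
  \<comment> \<open>Since u is a unit vector, \<open>s \<bullet> u\<close> grows at rate r in the
    direction \<open>r *\<^sub>R u\<close>, so that the velocity is r times X.\<close>
  have push: "pushforward A \<sigma> s (coord_vec euclidean_atlas (UNIV, id) s (r *\<^sub>R u)) = r *\<^sub>R X (\<sigma> s)"
    if s: "s \<in> W" for s r
  proof
    fix f
    have Xs: "X (\<sigma> s) = coord_vec A C (\<sigma> s) (F (c s))" using XF[OF c_S[OF s]] by (simp add: \<sigma>_def)
    show "pushforward A \<sigma> s (coord_vec euclidean_atlas (UNIV, id) s (r *\<^sub>R u)) f = (r *\<^sub>R X (\<sigma> s)) f"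
    proof (cases "smooth_at A (\<sigma> s) f")
      case f: True
      have fd: "((\<lambda>z. f (chart_inv C z)) has_derivative (\<lambda>v. coord_vec A C (\<sigma> s) v f)) (at (c s))"
        using smooth_at_has_derivative[OF C(1) \<sigma>_dom[OF s] f] c_\<sigma>[OF s] by simp
      have "((\<lambda>z. (f \<circ> \<sigma>) (chart_inv (UNIV, id) z)) has_derivative
          (\<lambda>h. coord_vec A C (\<sigma> s) ((h \<bullet> u) *\<^sub>R F (c s)) f)) (at (snd (UNIV, id) s))"
        using has_derivative_compose[OF c_der[OF s] fd] by (simp add: chart_inv_UNIV_id \<sigma>_def)
      moreover have "smooth_at euclidean_atlas s (f \<circ> \<sigma>)"
        using smooth_\<sigma>[OF s] f by (simp add: smooth_map_at_def)
      ultimately have "coord_vec euclidean_atlas (UNIV, id) s (r *\<^sub>R u) (f \<circ> \<sigma>)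
          = coord_vec A C (\<sigma> s) (((r *\<^sub>R u) \<bullet> u) *\<^sub>R F (c s)) f"
        by (intro E.coord_vec_eqI[OF id_chart]) (simp_all add: comp_def)
      also have "\<dots> = r * X (\<sigma> s) f"
        using u linear_scale[OF linear_coord_vec[OF C(1) \<sigma>_dom[OF s]]] by (simp add: Xs)
      finally show ?thesis using f by (simp add: pushforward_def)
    next
      case False
      then show ?thesis by (simp add: pushforward_def Xs coord_vec_not_smooth)
    qed
  qed
  show "\<exists>\<sigma> W S. open W \<and> (0::'n) \<in> W \<and> subspace S \<and> \<sigma> 0 = q \<and>
       (\<forall>s\<in>W. smooth_map_at euclidean_atlas A \<sigma> s) \<and>
       (\<forall>s\<in>W \<inter> S. let T = coord_vec euclidean_atlas (UNIV, id) s ` S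
          in inj_on (pushforward A \<sigma> s) T \<and> pushforward A \<sigma> s ` T = D (\<sigma> s))"
  proof (intro exI conjI ballI)
    show "open W" by (rule oW)
    show "0 \<in> W" using e by (simp add: W_def)
    show "subspace (span {u})" by simp
    show "\<sigma> 0 = q" using \<gamma>(1) C by (simp add: \<sigma>_def c_def)
    show "smooth_map_at euclidean_atlas A \<sigma> s" if "s \<in> W" for s by (rule smooth_\<sigma>[OF that])
    fix s assume "s \<in> W \<inter> span {u}"
    then have s: "s \<in> W" by blast
    let ?T = "coord_vec euclidean_atlas (UNIV, id) s ` span {u}"
    have "inj_on (pushforward A \<sigma> s) ?T"
      by (rule inj_onI) (use push[OF s] nz in \<open>auto simp: span_singleton\<close>)
    moreover have "pushforward A \<sigma> s ` ?T = D (\<sigma> s)"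
      unfolding D span_singleton image_image by (simp add: push[OF s] image_def)
    ultimately show "let T = ?T in inj_on (pushforward A \<sigma> s) T \<and> pushforward A \<sigma> s ` T = D (\<sigma> s)"
      unfolding Let_def by blast
  qed
qed

end

section \<open>LP-Sasakian manifolds\<close>

lemma sum_apply: "(\<Sum>b\<in>I. F b) x = (\<Sum>b\<in>I. F b x)"
  by (induction I rule: infinite_finite_induct) simp_all

lemma linear_map_on_sum:
  assumes "linear_map_on V f" "subspace V" "\<And>b. b \<in> I \<Longrightarrow> v b \<in> V"
  shows "f (\<Sum>b\<in>I. c b *\<^sub>R v b) = (\<Sum>b\<in>I. c b *\<^sub>R f (v b))"
  using assms(3)
proof (induction I rule: infinite_finite_induct)
  case (insert b I)
  then show ?case
    using assms(1,2) by (simp add: linear_map_on_def subspace_sum subspace_mul)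
next
  case empty
  have "f (0 *\<^sub>R 0) = 0 *\<^sub>R f 0"
    using assms(1,2) unfolding linear_map_on_def by (meson subspace_0)
  then show ?case by simp
next
  case (infinite I)
  have "f (0 *\<^sub>R 0) = 0 *\<^sub>R f 0"
    using assms(1,2) unfolding linear_map_on_def by (meson subspace_0)
  then show ?case using infinite by simp
qed

locale lp_sasakian = smooth_manifold A
  for A :: "('p::{t2_space,second_countable_topology}, 'n::euclidean_space) chart set" +
  fixes \<phi> :: "'p \<Rightarrow> 'p tvec \<Rightarrow> 'p tvec"
    and \<xi> :: "'p \<Rightarrow> 'p tvec"
    and \<eta> :: "'p \<Rightarrow> 'p tvec \<Rightarrow> real"
    and g :: "'p \<Rightarrow> 'p tvec \<Rightarrow> 'p tvec \<Rightarrow> real"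
    and nabla :: "'p conn"
  assumes LP_Sasakian: "LP_Sasakian A \<phi> \<xi> \<eta> g nabla"
begin

abbreviation T :: "'p \<Rightarrow> 'p tvec set" where "T \<equiv> tangent_space A"

lemmas LP = LP_Sasakian[unfolded LP_Sasakian_def]

lemma lorentzian: "lorentzian_metric A g" and levi_civita: "levi_civita A g nabla"
  and tensor_phi: "tensor_field_11 A \<phi>"
  using LP by blast+

lemma xi_field: "smooth_field_at A p \<xi>"
  using LP unfolding vector_field_def by blast

lemma T_closed: "0 \<in> T p" "u \<in> T p \<Longrightarrow> v \<in> T p \<Longrightarrow> u + v \<in> T p"
  "u \<in> T p \<Longrightarrow> r *\<^sub>R u \<in> T p" "(\<And>b. b \<in> I \<Longrightarrow> h b \<in> T p) \<Longrightarrow> (\<Sum>b\<in>I. h b) \<in> T p"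
  using subspace_tangent_space[of p] by (auto simp: subspace_def subspace_sum)

lemma xi_in_T: "\<xi> p \<in> T p"
  using smooth_field_atD(2)[OF xi_field] .

lemma phi_in_T: "u \<in> T p \<Longrightarrow> \<phi> p u \<in> T p"
  and linear_phi: "linear_map_on (T p) (\<phi> p)"
  and phi_field: "smooth_field_at A p V \<Longrightarrow> smooth_field_at A p (\<lambda>x. \<phi> x (V x))"
  using tensor_phi unfolding tensor_field_11_def by blast+

lemmas g_linear = lorentzian[unfolded lorentzian_metric_def, THEN conjunct1, rule_format]
lemmas g_sym = lorentzian[unfolded lorentzian_metric_def, THEN conjunct2, THEN conjunct1, rule_format]
lemmas g_smooth =
  lorentzian[unfolded lorentzian_metric_def, THEN conjunct2, THEN conjunct2, THEN conjunct1, rule_format]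

lemma g_add_right: "u \<in> T p \<Longrightarrow> v \<in> T p \<Longrightarrow> w \<in> T p \<Longrightarrow> g p u (v + w) = g p u v + g p u w"
  and g_scale_right: "u \<in> T p \<Longrightarrow> v \<in> T p \<Longrightarrow> g p u (r *\<^sub>R v) = r * g p u v"
  using g_linear unfolding linear_map_on_def by auto

lemma g_add_left: "u \<in> T p \<Longrightarrow> v \<in> T p \<Longrightarrow> w \<in> T p \<Longrightarrow> g p (u + v) w = g p u w + g p v w"
  using g_add_right[of w p u v] by (simp add: g_sym T_closed)

lemma g_scale_left: "u \<in> T p \<Longrightarrow> v \<in> T p \<Longrightarrow> g p (r *\<^sub>R u) v = r * g p u v"
  using g_scale_right[of v p u r] by (simp add: g_sym T_closed)

lemma g_sum_right:
  assumes "u \<in> T p" "\<And>b. b \<in> I \<Longrightarrow> v b \<in> T p"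
  shows "g p u (\<Sum>b\<in>I. c b *\<^sub>R v b) = (\<Sum>b\<in>I. c b * g p u (v b))"
proof -
  have "g p u (\<Sum>b\<in>I. c b *\<^sub>R v b) = (\<Sum>b\<in>I. c b *\<^sub>R g p u (v b))"
    by (rule linear_map_on_sum[OF g_linear[OF assms(1)] subspace_tangent_space]) (rule assms(2))
  then show ?thesis by simp
qed

lemma g_sum_sum:
  assumes "\<And>a. a \<in> I \<Longrightarrow> u a \<in> T p" "\<And>b. b \<in> J \<Longrightarrow> v b \<in> T p"
  shows "g p (\<Sum>a\<in>I. c a *\<^sub>R u a) (\<Sum>b\<in>J. d b *\<^sub>R v b) = (\<Sum>a\<in>I. \<Sum>b\<in>J. c a * d b * g p (u a) (v b))"
proof -
  have v: "(\<Sum>b\<in>J. d b *\<^sub>R v b) \<in> T p" using assms by (intro T_closed)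
  have u: "(\<Sum>a\<in>I. c a *\<^sub>R u a) \<in> T p" using assms by (intro T_closed)
  have "g p (\<Sum>a\<in>I. c a *\<^sub>R u a) (\<Sum>b\<in>J. d b *\<^sub>R v b) = (\<Sum>a\<in>I. c a * g p (u a) (\<Sum>b\<in>J. d b *\<^sub>R v b))"
    using g_sum_right[OF v assms(1)] g_sym[OF u v] g_sym[OF assms(1) v] by simp
  also have "\<dots> = (\<Sum>a\<in>I. c a * (\<Sum>b\<in>J. d b * g p (u a) (v b)))"
    using assms by (simp add: g_sum_right)
  finally show ?thesis by (simp add: sum_distrib_left mult.assoc)
qed

section \<open>Pointwise algebra of the structure tensors\<close>

lemma eta_xi: "\<eta> p (\<xi> p) = -1"
  and phi_phi: "u \<in> T p \<Longrightarrow> \<phi> p (\<phi> p u) = u + \<eta> p u *\<^sub>R \<xi> p"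
  and g_phi_phi: "u \<in> T p \<Longrightarrow> v \<in> T p \<Longrightarrow> g p (\<phi> p u) (\<phi> p v) = g p u v + \<eta> p u * \<eta> p v"
  and g_xi: "u \<in> T p \<Longrightarrow> g p u (\<xi> p) = \<eta> p u"
  and nabla_xi: "u \<in> T p \<Longrightarrow> nabla p u \<xi> = \<phi> p u"
  and nabla_phi: "u \<in> T p \<Longrightarrow> smooth_field_at A p V \<Longrightarrow>
       nabla p u (\<lambda>x. \<phi> x (V x)) - \<phi> p (nabla p u V) =
         g p u (V p) *\<^sub>R \<xi> p + \<eta> p (V p) *\<^sub>R u + (2 * \<eta> p u * \<eta> p (V p)) *\<^sub>R \<xi> p"
  using LP by blast+

lemma phi_add: "u \<in> T p \<Longrightarrow> v \<in> T p \<Longrightarrow> \<phi> p (u + v) = \<phi> p u + \<phi> p v"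
  and phi_scale: "u \<in> T p \<Longrightarrow> \<phi> p (r *\<^sub>R u) = r *\<^sub>R \<phi> p u"
  using linear_phi unfolding linear_map_on_def by auto

text \<open>Put u = \<open>\<phi> \<xi>\<close>. The square of \<open>\<phi>\<close> kills
  \<open>\<xi>\<close>, so \<open>\<phi> u = 0\<close>, and the same formula at u reads
  \<open>0 = u + \<eta>(u) \<xi>\<close>. Applying \<open>\<phi>\<close> gives
  \<open>\<eta>(u) u = 0\<close>, and either factor being 0 forces u = 0.\<close>

lemma phi_xi: "\<phi> p (\<xi> p) = 0"
proof (rule ccontr)
  assume nz: "\<phi> p (\<xi> p) \<noteq> 0"
  let ?u = "\<phi> p (\<xi> p)"
  have u: "?u \<in> T p" using phi_in_T xi_in_T by blast
  have phi2: "\<phi> p ?u = 0" using phi_phi[OF xi_in_T, of p] by (simp add: eta_xi)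
  have phi0: "\<phi> p 0 = 0" using phi_scale[OF T_closed(1), of p 0] by simp
  have eq: "?u + \<eta> p ?u *\<^sub>R \<xi> p = 0" using phi_phi[OF u] phi2 phi0 by simp
  have "\<phi> p (?u + \<eta> p ?u *\<^sub>R \<xi> p) = \<eta> p ?u *\<^sub>R ?u"
    using u xi_in_T phi2 by (simp add: phi_add phi_scale T_closed)
  then have "\<eta> p ?u = 0" using eq phi0 nz by simp
  then show False using eq nz by simp
qed

text \<open>The cube of \<open>\<phi>\<close> at u is \<open>\<phi> u\<close> when the inner square
  is expanded, and \<open>\<phi> u + \<eta>(\<phi> u) \<xi>\<close> when the outer one is.\<close>

lemma eta_phi: "u \<in> T p \<Longrightarrow> \<eta> p (\<phi> p u) = 0"
proof -
  assume u: "u \<in> T p"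
  have "\<phi> p (\<phi> p (\<phi> p u)) = \<phi> p u"
    using phi_phi[OF u] u xi_in_T by (simp add: phi_add phi_scale T_closed phi_xi)
  then have "\<eta> p (\<phi> p u) *\<^sub>R \<xi> p = 0" using phi_phi[OF phi_in_T[OF u]] by simp
  moreover have "\<xi> p \<noteq> 0" using eta_xi[of p] g_xi[OF T_closed(1), of p] g_xi[OF xi_in_T, of p]
    using g_scale_right[OF xi_in_T xi_in_T, of p 0] by force
  ultimately show ?thesis by simp
qed

text \<open>Both sides evaluate \<open>g(\<phi> u, \<phi> (\<phi> v))\<close>: once by expanding the
  square, once by the compatibility of g with \<open>\<phi>\<close>; the \<open>\<eta>\<close> terms
  vanish by \<open>eta_phi\<close>.\<close>

lemma g_phi_sym: "u \<in> T p \<Longrightarrow> v \<in> T p \<Longrightarrow> g p (\<phi> p u) v = g p (\<phi> p v) u"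
proof -
  assume uv: "u \<in> T p" "v \<in> T p"
  have "g p (\<phi> p u) (\<phi> p (\<phi> p v)) = g p (\<phi> p u) v"
    using uv xi_in_T by (simp add: phi_phi g_add_right g_scale_right phi_in_T T_closed g_xi eta_phi)
  moreover have "g p (\<phi> p u) (\<phi> p (\<phi> p v)) = g p u (\<phi> p v)"
    using uv by (simp add: g_phi_phi phi_in_T eta_phi)
  ultimately show ?thesis using g_sym[OF uv(1) phi_in_T[OF uv(2)]] by simp
qed

text \<open>The metric is positive definite on the orthogonal complement of the timelike \<open>\<xi>\<close>.\<close>

lemma null_orthogonal_xi_eq_0:
  assumes u: "u \<in> T p" and orth: "g p u (\<xi> p) = 0" and null: "g p u u = 0"
  shows "u = 0"
proof -
  obtain t E where tE: "t \<notin> E" "span (insert t E) = T p" "g p t t = -1"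
    and E: "\<And>e. e \<in> E \<Longrightarrow> g p t e = 0" "\<And>e. e \<in> E \<Longrightarrow> g p e e = 1"
    "\<And>e f. e \<in> E \<Longrightarrow> f \<in> E \<Longrightarrow> e \<noteq> f \<Longrightarrow> g p e f = 0"
  proof -
    have "\<exists>t E. t \<notin> E \<and> independent (insert t E) \<and> span (insert t E) = T p \<and>
       g p t t = -1 \<and> (\<forall>e\<in>E. g p t e = 0 \<and> g p e e = 1) \<and>
       (\<forall>e\<in>E. \<forall>f\<in>E. e \<noteq> f \<longrightarrow> g p e f = 0)"
      using lorentzian[unfolded lorentzian_metric_def, THEN conjunct2, THEN conjunct2, THEN conjunct2] by blast
    then obtain t E where "t \<notin> E \<and> independent (insert t E) \<and> span (insert t E) = T p \<and>
       g p t t = -1 \<and> (\<forall>e\<in>E. g p t e = 0 \<and> g p e e = 1) \<and>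
       (\<forall>e\<in>E. \<forall>f\<in>E. e \<noteq> f \<longrightarrow> g p e f = 0)" by (elim exE)
    then show ?thesis by (intro that[of t E]) simp_all
  qed
  have t: "t \<in> T p" and ET: "E \<subseteq> T p" using span_superset[of "insert t E"] by (simp_all add: tE(2))
  have sE: "span E \<subseteq> T p" using span_mono[of E "insert t E"] tE(2) by auto
  \<comment> \<open>On \<open>span E\<close> the metric is a sum of squares; each vector involves
    finitely many members of E.\<close>
  have pos: "g p s s \<ge> 0 \<and> (g p s s = 0 \<longrightarrow> s = 0) \<and> g p t s = 0" if "s \<in> span E" for s
  proof -
    obtain F r where F: "finite F" "F \<subseteq> E" and s: "s = (\<Sum>a\<in>F. r a *\<^sub>R a)"
      using \<open>s \<in> span E\<close> unfolding span_explicit by blast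
    have "g p s s = (\<Sum>a\<in>F. \<Sum>b\<in>F. r a * r b * g p a b)"
      unfolding s using g_sum_sum[of F "\<lambda>a. a" p F "\<lambda>a. a" r r] F ET by blast
    also have "\<dots> = (\<Sum>a\<in>F. \<Sum>b\<in>F. if b = a then r a * r a else 0)"
    proof (intro sum.cong refl)
      fix a b assume "a \<in> F" "b \<in> F"
      then show "r a * r b * g p a b = (if b = a then r a * r a else 0)"
        using E F(2) by (cases "a = b") (auto simp: subset_eq)
    qed
    also have "\<dots> = (\<Sum>a\<in>F. (r a)\<^sup>2)" using F by (simp add: sum.delta power2_eq_square)
    finally have gs: "g p s s = (\<Sum>a\<in>F. (r a)\<^sup>2)" .
    have "g p s s \<ge> 0" unfolding gs by (simp add: sum_nonneg)
    moreover have "s = 0" if "g p s s = 0"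
    proof -
      have "\<forall>a\<in>F. r a = 0" using that unfolding gs by (simp add: sum_nonneg_eq_0_iff F)
      then show ?thesis unfolding s by simp
    qed
    moreover have "g p t s = 0"
      unfolding s using g_sum_right[OF t, of F "\<lambda>a. a" r] F ET E(1) by (simp add: subset_eq)
    ultimately show ?thesis by blast
  qed
  \<comment> \<open>Both u and \<open>\<xi>\<close> are split into a multiple of t and a spacelike
    part: u = a t + s and \<open>\<xi>\<close> = c t + r.\<close>
  obtain a where a: "u - a *\<^sub>R t \<in> span E" using u tE(2) span_breakdown_eq by metis
  obtain c where c: "\<xi> p - c *\<^sub>R t \<in> span E" using xi_in_T[of p] tE(2) span_breakdown_eq by metis
  define s r where "s = u - a *\<^sub>R t" and "r = \<xi> p - c *\<^sub>R t"
  have sr: "s \<in> span E" "r \<in> span E" "s \<in> T p" "r \<in> T p" using a c sE by (auto simp: s_def r_def)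
  have us: "u = a *\<^sub>R t + s" and xr: "\<xi> p = c *\<^sub>R t + r" by (auto simp: s_def r_def)
  have ts: "g p t s = 0" "g p t r = 0" using pos sr by auto
  then have st: "g p s t = 0" "g p r t = 0" using g_sym[OF sr(3) t] g_sym[OF sr(4) t] by simp_all
  note expand = g_add_left g_add_right g_scale_left g_scale_right T_closed t sr ts st tE(3)
  have 1: "g p s s = a * a" using null unfolding us by (simp add: expand)
  have 2: "g p s r = a * c" using orth unfolding us xr by (simp add: expand)
  have 3: "g p r r = c * c - 1" using g_xi[OF xi_in_T, of p] eta_xi[of p] unfolding xr by (simp add: expand)
  have rs: "g p r s = a * c" using 2 g_sym[OF sr(3,4)] by simp
  \<comment> \<open>In c s - a r the terms in a^2 c^2 cancel: c^2 a^2 - 2 a^2 c^2 + a^2 (c^2 - 1) =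
    - a^2. Nonnegativity on \<open>span E\<close> then forces a = 0.\<close>
  have "c *\<^sub>R s + (- a) *\<^sub>R r \<in> span E" using sr by (intro span_add span_scale)
  then have "g p (c *\<^sub>R s + (- a) *\<^sub>R r) (c *\<^sub>R s + (- a) *\<^sub>R r) \<ge> 0" using pos by blast
  moreover have "g p (c *\<^sub>R s + (- a) *\<^sub>R r) (c *\<^sub>R s + (- a) *\<^sub>R r) = - (a * a)"
    by (simp only: expand 1 2 3 rs) (simp add: algebra_simps)
  ultimately have "a * a \<le> 0" by simp
  then have "a = 0" by (auto simp: mult_le_0_iff)
  moreover have "s = 0" using pos sr(1) 1 \<open>a = 0\<close> by simp
  ultimately show ?thesis using us by simp
qed

section \<open>The Levi-Civita connection\<close>

lemma nabla_in_T: "smooth_field_at A p V \<Longrightarrow> u \<in> T p \<Longrightarrow> nabla p u V \<in> T p"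
  using levi_civita[unfolded levi_civita_def affine_connection_def, THEN conjunct1, THEN conjunct1] by blast

lemma nabla_torsion_free: "smooth_field_at A p V \<Longrightarrow> smooth_field_at A p W \<Longrightarrow>
    lie_bracket A V W p = nabla p (V p) W - nabla p (W p) V"
  using levi_civita[unfolded levi_civita_def, THEN conjunct2, THEN conjunct1] by simp

lemma nabla_metric: "v \<in> T p \<Longrightarrow> smooth_field_at A p V \<Longrightarrow> smooth_field_at A p W \<Longrightarrow>
    v (\<lambda>x. g x (V x) (W x)) = g p (nabla p v V) (W p) + g p (V p) (nabla p v W)"
  using levi_civita[unfolded levi_civita_def, THEN conjunct2, THEN conjunct2] by simp

text \<open>For u = \<open>\<xi>\<close> the right side of \<open>nabla_phi\<close> is
  \<open>\<eta>(V) \<xi>\<close> taken 1 + 1 - 2 times, the last sign coming from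
  \<open>\<eta>(\<xi>) = -1\<close>.\<close>

lemma nabla_xi_phi:
  assumes V: "smooth_field_at A p V"
  shows "nabla p (\<xi> p) (\<lambda>x. \<phi> x (V x)) = \<phi> p (nabla p (\<xi> p) V)"
proof -
  have Vp: "V p \<in> T p" using smooth_field_atD(2)[OF V] .
  have "nabla p (\<xi> p) (\<lambda>x. \<phi> x (V x)) - \<phi> p (nabla p (\<xi> p) V)
      = (\<eta> p (V p) + \<eta> p (V p) - 2 * \<eta> p (V p)) *\<^sub>R \<xi> p"
    using nabla_phi[OF xi_in_T V] g_sym[OF xi_in_T Vp] g_xi[OF Vp] eta_xi[of p]
    by (simp add: algebra_simps flip: scaleR_add_left)
  then show ?thesis by simp
qed

end

section \<open>CR-submanifolds with vertical structure vector field\<close>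

locale xi_vertical_CR = lp_sasakian A \<phi> \<xi> \<eta> g nabla + B: smooth_manifold B
  for A :: "('p::{t2_space,second_countable_topology}, 'n::euclidean_space) chart set"
    and \<phi> \<xi> \<eta> g nabla
    and B :: "('q::{t2_space,second_countable_topology}, 'm::euclidean_space) chart set" +
  fixes i :: "'q \<Rightarrow> 'p" and D :: "'q \<Rightarrow> 'q tvec set" and X :: "'q \<Rightarrow> 'q tvec"
  assumes CR: "CR_submanifold B A i \<phi> \<xi> g D"
    and X_section: "smooth_section B (orth_complement B A i g D) X"
    and push_X: "pushforward A i q (X q) = \<xi> (i q)"
begin

abbreviation Dperp :: "'q \<Rightarrow> 'q tvec set" where "Dperp \<equiv> orth_complement B A i g D"
abbreviation push :: "'q \<Rightarrow> 'q tvec \<Rightarrow> 'p tvec" where "push \<equiv> pushforward A i"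

lemma smooth_i: "smooth_map_at B A i q"
  and inj_push: "inj_on (push q) (tangent_space B q)"
  using CR unfolding CR_submanifold_def immersion_def by blast+

lemma push_in_T: "v \<in> tangent_space B q \<Longrightarrow> push q v \<in> T (i q)"
  using pushforward_in_tangent_space[OF B.smooth_atlas _ smooth_i] .

lemma push_eq: "smooth_at A (i q) f \<Longrightarrow> push q v f = v (\<lambda>y. f (i y))"
  by (simp add: pushforward_def comp_def)

lemma push_scale: "push q (r *\<^sub>R v) = r *\<^sub>R push q v"
  by (auto simp: pushforward_def)

lemma smooth_at_comp_i: "smooth_at A (i q) f \<Longrightarrow> smooth_at B q (\<lambda>y. f (i y))"
  using smooth_i unfolding smooth_map_at_def comp_def by blast

lemma eventually_i: "\<forall>\<^sub>F x in nhds (i q). P x \<Longrightarrow> \<forall>\<^sub>F y in nhds q. P (i y)"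
  using eventually_nhds_image smooth_i unfolding smooth_map_at_def by blast

lemma X_field: "smooth_field_at B q X" and X_Dperp: "X q \<in> Dperp q" and X_tangent: "X q \<in> tangent_space B q"
  using X_section B.smooth_field_atD(2) unfolding smooth_section_def vector_field_def by blast+

text \<open>Separates a field along i into coefficients, which are smooth on M, and frame fields,
  which are defined on the ambient manifold so that \<open>nabla\<close> applies to them.\<close>

lemma push_field_frame:
  assumes Y: "smooth_field_at B q Y" and C: "C \<in> A" "i q \<in> fst C"
  shows "\<forall>\<^sub>F y in nhds q. push y (Y y) = (\<Sum>b\<in>Basis. push y (Y y) (\<lambda>x. snd C x \<bullet> b) *\<^sub>R coord_vec A C (i y) b)"
    and "smooth_at B q (\<lambda>y. push y (Y y) (\<lambda>x. snd C x \<bullet> b))"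
proof -
  have "\<forall>\<^sub>F x in nhds (i q). x \<in> fst C" using C open_chart_domain eventually_nhds_in_open by blast
  then have dom: "\<forall>\<^sub>F y in nhds q. i y \<in> fst C" by (rule eventually_i)
  then show "\<forall>\<^sub>F y in nhds q. push y (Y y) = (\<Sum>b\<in>Basis. push y (Y y) (\<lambda>x. snd C x \<bullet> b) *\<^sub>R coord_vec A C (i y) b)"
    using B.smooth_field_atD(1)[OF Y]
    by eventually_elim (rule tangent_vector_eq_sum[OF push_in_T C(1)])
  have "\<forall>\<^sub>F y in nhds q. Y y (\<lambda>y. snd C (i y) \<bullet> b) = push y (Y y) (\<lambda>x. snd C x \<bullet> b)"
    using dom by eventually_elim (simp add: push_eq smooth_at_coord[OF C(1)])
  then show "smooth_at B q (\<lambda>y. push y (Y y) (\<lambda>x. snd C x \<bullet> b))"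
    by (rule B.smooth_at_cong[OF B.smooth_field_atD(3)[OF Y smooth_at_comp_i[OF smooth_at_coord[OF C]]]])
qed

text \<open>\<open>DV\<close> is \<open>\<nabla>\<^sub>X V\<close> for the field \<open>V = i\<^sub>* Y\<close> along \<open>i\<close>, written in the coordinate frame of a
  chart; this avoids proving torsion-freeness and metricity of the pullback connection.\<close>

lemma derivative_along_X:
  assumes Y: "smooth_field_at B q Y" and C: "C \<in> A" "i q \<in> fst C"
  defines "f \<equiv> \<lambda>b y. push y (Y y) (\<lambda>x. snd C x \<bullet> b)"
  defines "DV \<equiv> (\<Sum>b\<in>Basis. X q (f b) *\<^sub>R coord_vec A C (i q) b)
    + (\<Sum>b\<in>Basis. f b q *\<^sub>R nabla (i q) (\<xi> (i q)) (\<lambda>x. coord_vec A C x b))"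
  shows "DV = \<phi> (i q) (push q (Y q)) + push q (lie_bracket B X Y q)" (is "_ = ?R")
    and "X q (\<lambda>y. g (i y) (\<phi> (i y) (push y (Y y))) (push y (Y y)))
      = 2 * g (i q) (\<phi> (i q) (push q (Y q))) DV"
proof -
  let ?p = "i q"
  define E where "E b x = coord_vec A C x b" for b x
  define N where "N b = nabla ?p (\<xi> ?p) (E b)" for b
  define V where "V y = push y (Y y)" for y
  have E_field: "smooth_field_at A ?p (E b)" for b
    unfolding E_def by (rule smooth_field_at_coord_vec[OF C])
  have ET: "E b ?p \<in> T ?p" for b using smooth_field_atD(2)[OF E_field] .
  have NT: "N b \<in> T ?p" for b unfolding N_def by (rule nabla_in_T[OF E_field xi_in_T])
  have V: "\<forall>\<^sub>F y in nhds q. V y = (\<Sum>b\<in>Basis. f b y *\<^sub>R E b (i y))"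
    using push_field_frame(1)[OF Y C] by (simp add: V_def f_def E_def)
  then have Vq: "V q = (\<Sum>b\<in>Basis. f b q *\<^sub>R E b ?p)" by (rule eventually_nhds_x_imp_x)
  have f: "smooth_at B q (f b)" for b
    unfolding f_def by (rule push_field_frame(2)[OF Y C])
  have Yq: "Y q \<in> tangent_space B q" using B.smooth_field_atD(2)[OF Y] .
  have VT: "V q \<in> T ?p" unfolding V_def by (rule push_in_T[OF Yq])
  have DV: "DV = (\<Sum>b\<in>Basis. X q (f b) *\<^sub>R E b ?p) + (\<Sum>b\<in>Basis. f b q *\<^sub>R N b)"
    unfolding DV_def E_def[abs_def] N_def ..
  have DT: "(\<Sum>b\<in>Basis. X q (f b) *\<^sub>R E b ?p) \<in> T ?p" "(\<Sum>b\<in>Basis. f b q *\<^sub>R N b) \<in> T ?p"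
    using ET NT by (auto intro!: T_closed)
  have X_comp: "X q (\<lambda>y. h (i y)) = \<xi> ?p h" if "smooth_at A ?p h" for h
    using push_eq[OF that, of "X q"] push_X by simp
  have phiV: "\<phi> ?p (V q) = (\<Sum>b\<in>Basis. f b q *\<^sub>R \<phi> ?p (E b ?p))"
    unfolding Vq by (rule linear_map_on_sum[OF linear_phi subspace_tangent_space]) (rule ET)
  have R: "?R = \<phi> ?p (V q) + push q (lie_bracket B X Y q)" by (simp add: V_def)
  have bracketT: "push q (lie_bracket B X Y q) \<in> T ?p"
    by (rule push_in_T[OF B.lie_bracket_in_tangent_space[OF X_field Y]])
  show "DV = ?R"
  proof
    fix h
    show "DV h = ?R h"
    proof (cases "smooth_at A ?p h")
      case False
      \<comment> \<open>On functions that are not smooth both sides take the default value 0, as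
        tangent vectors.\<close>
      have "DV \<in> T ?p" unfolding DV by (rule T_closed(2)[OF DT])
      moreover have "?R \<in> T ?p" unfolding R using VT bracketT by (intro T_closed phi_in_T)
      ultimately show ?thesis using tangent_vector_not_smooth[OF _ False] by metis
    next
      case h: True
      have "\<forall>\<^sub>F y in nhds q. smooth_at A (i y) h" using eventually_smooth_at[OF h] by (rule eventually_i)
      then have ev: "\<forall>\<^sub>F y in nhds q. Y y (\<lambda>y. h (i y)) = (\<Sum>b\<in>Basis. f b y * E b (i y) h)"
        "\<forall>\<^sub>F y in nhds q. X y (\<lambda>y. h (i y)) = \<xi> (i y) h"
      proof -
        assume sm: "\<forall>\<^sub>F y in nhds q. smooth_at A (i y) h"
        show "\<forall>\<^sub>F y in nhds q. Y y (\<lambda>y. h (i y)) = (\<Sum>b\<in>Basis. f b y * E b (i y) h)"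
          using sm V
        proof eventually_elim
          case (elim y)
          have "Y y (\<lambda>y. h (i y)) = V y h" unfolding V_def using push_eq[OF elim(1)] by simp
          then show ?case by (simp add: elim(2) sum_apply)
        qed
        show "\<forall>\<^sub>F y in nhds q. X y (\<lambda>y. h (i y)) = \<xi> (i y) h"
          using sm by eventually_elim (simp add: push_X flip: push_eq)
      qed
      have Eh: "smooth_at A ?p (\<lambda>x. E b x h)" for b using smooth_field_atD(3)[OF E_field h] .
      have xih: "smooth_at A ?p (\<lambda>x. \<xi> x h)" using smooth_field_atD(3)[OF xi_field h] .
      have "X q (\<lambda>y. Y y (\<lambda>y. h (i y))) = X q (\<lambda>y. \<Sum>b\<in>Basis. f b y * E b (i y) h)"
        by (rule B.tangent_vector_cong[OF X_tangent ev(1)])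
      also have "\<dots> = (\<Sum>b\<in>Basis. X q (\<lambda>y. f b y * E b (i y) h))"
        by (intro B.tangent_vector_sum[OF X_tangent] B.smooth_at_mult f smooth_at_comp_i[OF Eh]) simp
      also have "\<dots> = (\<Sum>b\<in>Basis. X q (f b) * E b ?p h + f b q * X q (\<lambda>y. E b (i y) h))"
        by (intro sum.cong refl B.tangent_vector_mult[OF X_tangent] f smooth_at_comp_i[OF Eh])
      finally have XY: "X q (\<lambda>y. Y y (\<lambda>y. h (i y)))
          = (\<Sum>b\<in>Basis. X q (f b) * E b ?p h + f b q * \<xi> ?p (\<lambda>x. E b x h))"
        by (simp add: X_comp[OF Eh])
      have "Y q (\<lambda>y. X y (\<lambda>y. h (i y))) = Y q (\<lambda>y. \<xi> (i y) h)"
        by (rule B.tangent_vector_cong[OF Yq ev(2)])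
      also have "\<dots> = V q (\<lambda>x. \<xi> x h)" unfolding V_def using push_eq[OF xih] by simp
      also have "\<dots> = (\<Sum>b\<in>Basis. f b q * E b ?p (\<lambda>x. \<xi> x h))" by (simp add: Vq sum_apply)
      finally have YX: "Y q (\<lambda>y. X y (\<lambda>y. h (i y))) = (\<Sum>b\<in>Basis. f b q * E b ?p (\<lambda>x. \<xi> x h))" .
      \<comment> \<open>Torsion-freeness enters here, for the ambient fields \<open>\<xi>\<close>
        and \<open>E b\<close>; the derivative of \<open>\<xi>\<close> along \<open>E b\<close> is
        \<open>\<phi> (E b)\<close>.\<close>
      have br: "\<xi> ?p (\<lambda>x. E b x h) - E b ?p (\<lambda>x. \<xi> x h) = N b h - \<phi> ?p (E b ?p) h" for b
      proof -
        have "\<xi> ?p (\<lambda>x. E b x h) - E b ?p (\<lambda>x. \<xi> x h) = lie_bracket A \<xi> (E b) ?p h"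
          using h by (simp add: lie_bracket_def)
        also have "lie_bracket A \<xi> (E b) ?p = N b - \<phi> ?p (E b ?p)"
          unfolding N_def nabla_torsion_free[OF xi_field E_field] nabla_xi[OF ET] ..
        finally show ?thesis by simp
      qed
      have "push q (lie_bracket B X Y q) h = X q (\<lambda>y. Y y (\<lambda>y. h (i y))) - Y q (\<lambda>y. X y (\<lambda>y. h (i y)))"
        using push_eq[OF h] smooth_at_comp_i[OF h] by (simp add: lie_bracket_def)
      also have "\<dots> = (\<Sum>b\<in>Basis. X q (f b) * E b ?p h + f b q * (\<xi> ?p (\<lambda>x. E b x h) - E b ?p (\<lambda>x. \<xi> x h)))"
        unfolding XY YX by (simp add: sum.distrib sum_subtractf right_diff_distrib)
      also have "\<dots> = DV h - \<phi> ?p (V q) h"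
        unfolding br DV phiV by (simp add: sum.distrib sum_subtractf right_diff_distrib sum_apply)
      finally show ?thesis unfolding R by simp
    qed
  qed
  \<comment> \<open>The symmetric bilinear form whose diagonal value H(V, V) is to be
    differentiated; G below holds its coefficients in the frame.\<close>
  define H where "H u w = g ?p (\<phi> ?p u) w" for u w
  have H_sym: "H u w = H w u" if "u \<in> T ?p" "w \<in> T ?p" for u w
    unfolding H_def using g_phi_sym that by blast
  have H_sum: "H (\<Sum>b\<in>Basis. c b *\<^sub>R u b) (\<Sum>b\<in>Basis. d b *\<^sub>R w b)
      = (\<Sum>a\<in>Basis. \<Sum>b\<in>Basis. c a * d b * H (u a) (w b))"
    if "\<And>b. u b \<in> T ?p" "\<And>b. w b \<in> T ?p" for c d :: "'n \<Rightarrow> real" and u w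
  proof -
    have "\<phi> ?p (\<Sum>b\<in>Basis. c b *\<^sub>R u b) = (\<Sum>b\<in>Basis. c b *\<^sub>R \<phi> ?p (u b))"
      by (rule linear_map_on_sum[OF linear_phi subspace_tangent_space]) (rule that(1))
    then show ?thesis unfolding H_def by (simp only:) (rule g_sum_sum, intro phi_in_T that(1), rule that(2))
  qed
  define G where "G a b x = g x (\<phi> x (E a x)) (E b x)" for a b x
  have G: "smooth_at A ?p (G a b)" for a b
    unfolding G_def[abs_def] by (intro g_smooth phi_field E_field)
  \<comment> \<open>Metricity, with \<open>\<phi>\<close> moved past the derivative in the direction
    \<open>\<xi>\<close>.\<close>
  have xiG: "\<xi> ?p (G a b) = H (N a) (E b ?p) + H (E a ?p) (N b)" for a b
    unfolding G_def[abs_def] H_def N_def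
    using nabla_metric[OF xi_in_T phi_field[OF E_field] E_field] nabla_xi_phi[OF E_field] by simp
  have "\<forall>\<^sub>F x in nhds ?p. \<forall>b\<in>Basis. E b x \<in> T x"
    using smooth_field_atD(1)[OF E_field] by (simp add: eventually_ball_finite)
  then have ET': "\<forall>\<^sub>F y in nhds q. \<forall>b\<in>Basis. E b (i y) \<in> T (i y)" by (rule eventually_i)
  have "\<forall>\<^sub>F y in nhds q. g (i y) (\<phi> (i y) (V y)) (V y)
      = (\<Sum>a\<in>Basis. \<Sum>b\<in>Basis. (f a y * f b y) * G a b (i y))"
    using V ET'
  proof eventually_elim
    case (elim y)
    have "\<phi> (i y) (V y) = (\<Sum>b\<in>Basis. f b y *\<^sub>R \<phi> (i y) (E b (i y)))"
      unfolding elim(1) by (rule linear_map_on_sum[OF linear_phi subspace_tangent_space]) (use elim(2) in blast)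
    then show ?case
      unfolding G_def
      using g_sum_sum[of Basis "\<lambda>b. \<phi> (i y) (E b (i y))" "i y" Basis "\<lambda>b. E b (i y)" "\<lambda>b. f b y" "\<lambda>b. f b y"]
        elim phi_in_T by simp
  qed
  then have "X q (\<lambda>y. g (i y) (\<phi> (i y) (V y)) (V y))
      = X q (\<lambda>y. \<Sum>a\<in>Basis. \<Sum>b\<in>Basis. (f a y * f b y) * G a b (i y))"
    by (rule B.tangent_vector_cong[OF X_tangent])
  also have "\<dots> = (\<Sum>a\<in>Basis. X q (\<lambda>y. \<Sum>b\<in>Basis. (f a y * f b y) * G a b (i y)))"
    by (intro B.tangent_vector_sum[OF X_tangent] B.smooth_at_sum B.smooth_at_mult f smooth_at_comp_i[OF G]) simp
  also have "\<dots> = (\<Sum>a\<in>Basis. \<Sum>b\<in>Basis. X q (\<lambda>y. (f a y * f b y) * G a b (i y)))"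
    by (intro sum.cong refl B.tangent_vector_sum[OF X_tangent] B.smooth_at_mult f smooth_at_comp_i[OF G]) simp
  also have "\<dots> = (\<Sum>a\<in>Basis. \<Sum>b\<in>Basis. X q (\<lambda>y. f a y * f b y) * G a b ?p + (f a q * f b q) * \<xi> ?p (G a b))"
    by (intro sum.cong refl)
      (simp add: B.tangent_vector_mult[OF X_tangent B.smooth_at_mult[OF f f] smooth_at_comp_i[OF G]] X_comp[OF G])
  also have "\<dots> = (\<Sum>a\<in>Basis. \<Sum>b\<in>Basis. (X q (f a) * f b q + f a q * X q (f b)) * H (E a ?p) (E b ?p)
      + (f a q * f b q) * (H (N a) (E b ?p) + H (E a ?p) (N b)))"
    by (intro sum.cong refl) (simp add: B.tangent_vector_mult[OF X_tangent f f] xiG, simp add: G_def H_def)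
  \<comment> \<open>Derivatives of the coefficients and of the frame fields are collected: together
    they form \<open>DV\<close>, once in each argument of H.\<close>
  also have "\<dots> = H DV (V q) + H (V q) DV"
  proof -
    have "H DV (V q) = H (\<Sum>b\<in>Basis. X q (f b) *\<^sub>R E b ?p) (V q) + H (\<Sum>b\<in>Basis. f b q *\<^sub>R N b) (V q)"
      unfolding DV H_def using DT VT by (simp add: phi_add phi_in_T g_add_left)
    moreover have "H (V q) DV = H (V q) (\<Sum>b\<in>Basis. X q (f b) *\<^sub>R E b ?p) + H (V q) (\<Sum>b\<in>Basis. f b q *\<^sub>R N b)"
      unfolding DV H_def using DT VT by (simp add: phi_in_T g_add_right)
    ultimately show ?thesis
      unfolding Vq by (simp add: H_sum ET NT algebra_simps flip: sum.distrib)
  qed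
  also have "\<dots> = 2 * H (V q) DV"
    using H_sym[OF VT, of DV] T_closed(2)[OF DT] by (simp add: DV)
  finally show "X q (\<lambda>y. g (i y) (\<phi> (i y) (push y (Y y))) (push y (Y y)))
      = 2 * g ?p (\<phi> ?p (push q (Y q))) DV"
    by (simp add: V_def H_def)
qed

section \<open>The vertical distribution is a line field\<close>

lemma Dperp_tangent: "v \<in> Dperp q \<Longrightarrow> v \<in> tangent_space B q"
  by (simp add: orth_complement_def)

lemma phi_push_normal:
  "v \<in> Dperp q \<Longrightarrow> u \<in> tangent_space B q \<Longrightarrow> g (i q) (\<phi> (i q) (push q v)) (push q u) = 0"
  using CR unfolding CR_submanifold_def normal_space_def by blast

lemma Dperp_section_collinear:
  assumes Y: "smooth_field_at B q Y" and "\<forall>\<^sub>F y in nhds q. Y y \<in> Dperp y"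
  shows "Y q \<in> span {X q}"
proof -
  let ?p = "i q" and ?V = "push q (Y q)"
  obtain C where C: "C \<in> A" "?p \<in> fst C" by (rule obtain_chart)
  note d = derivative_along_X[OF Y C]
  have Yq: "Y q \<in> Dperp q" using assms(2) by (rule eventually_nhds_x_imp_x)
  have V: "?V \<in> T ?p" by (intro push_in_T Dperp_tangent Yq)
  have brT: "lie_bracket B X Y q \<in> tangent_space B q"
    by (rule B.lie_bracket_in_tangent_space[OF X_field Y])
  have "\<forall>\<^sub>F y in nhds q. g (i y) (\<phi> (i y) (push y (Y y))) (push y (Y y)) = 0"
    using assms(2) by eventually_elim (intro phi_push_normal Dperp_tangent)
  then have "X q (\<lambda>y. g (i y) (\<phi> (i y) (push y (Y y))) (push y (Y y))) = X q (\<lambda>y. 0)"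
    by (rule B.tangent_vector_cong[OF X_tangent])
  then have "g ?p (\<phi> ?p ?V) (\<phi> ?p ?V + push q (lie_bracket B X Y q)) = 0"
    using B.tangent_vector_const[OF X_tangent] d(2) unfolding d(1) by simp
  \<comment> \<open>The bracket of fields on M is tangent to M while \<open>\<phi> V\<close> is
    normal, so the bracket term drops out.\<close>
  then have "g ?p (\<phi> ?p ?V) (\<phi> ?p ?V) = 0"
    using phi_push_normal[OF Yq brT] V push_in_T[OF brT] by (simp add: g_add_right phi_in_T)
  then have gV: "g ?p ?V ?V = - (\<eta> ?p ?V * \<eta> ?p ?V)" by (simp add: g_phi_phi V)
  let ?u = "?V + \<eta> ?p ?V *\<^sub>R \<xi> ?p"
  have gx: "g ?p ?V (\<xi> ?p) = \<eta> ?p ?V" "g ?p (\<xi> ?p) ?V = \<eta> ?p ?V" "g ?p (\<xi> ?p) (\<xi> ?p) = -1"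
    using g_sym[OF xi_in_T V] g_xi[OF V] g_xi[OF xi_in_T] eta_xi by simp_all
  have "?u = 0"
    by (rule null_orthogonal_xi_eq_0[where p = ?p])
      (simp_all add: V xi_in_T T_closed g_add_left g_add_right g_scale_left g_scale_right gV gx)
  \<comment> \<open>\<open>\<xi>\<close> is the image of X, so the relation comes back to M through
    the injectivity of the differential.\<close>
  then have "?V = push q ((- \<eta> ?p ?V) *\<^sub>R X q)"
    unfolding push_scale push_X by (simp add: add_eq_0_iff2)
  then have "Y q = (- \<eta> ?p ?V) *\<^sub>R X q"
    by (rule inj_onD[OF inj_push]) (simp_all add: Dperp_tangent[OF Yq] X_tangent
        subspace_mul[OF B.subspace_tangent_space] subspace_neg[OF B.subspace_tangent_space])
  then show ?thesis by (metis span_base span_scale singletonI)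
qed

text \<open>Every member of a local frame is a local section, hence collinear with X at q; the frame
  spans, so the rank k need not be known beforehand.\<close>

lemma Dperp_eq_span: "Dperp q = span {X q}"
proof -
  have sd: "smooth_distribution B Dperp" using CR unfolding CR_submanifold_def by blast
  then obtain k where
    k: "(\<forall>q. Dperp q \<subseteq> tangent_space B q \<and> subspace (Dperp q) \<and> dim (Dperp q) = k) \<and>
       (\<forall>q. \<exists>F. (\<forall>j<k. smooth_field_at B q (F j)) \<and>
          (\<forall>\<^sub>F y in nhds q. Dperp y = span ((\<lambda>j. F j y) ` {..<k})))"
    unfolding smooth_distribution_def by (elim exE)
  have subspace: "subspace (Dperp q)" using k by simp
  have "\<exists>F. (\<forall>j<k. smooth_field_at B q (F j)) \<and>
      (\<forall>\<^sub>F y in nhds q. Dperp y = span ((\<lambda>j. F j y) ` {..<k}))"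
    using k by simp
  then obtain F where F: "\<And>j. j < k \<Longrightarrow> smooth_field_at B q (F j)"
    "\<forall>\<^sub>F y in nhds q. Dperp y = span ((\<lambda>j. F j y) ` {..<k})" by blast
  have "F j q \<in> span {X q}" if "j < k" for j
  proof (rule Dperp_section_collinear[OF F(1)[OF that]])
    show "\<forall>\<^sub>F y in nhds q. F j y \<in> Dperp y"
      using F(2) by eventually_elim (use that in \<open>auto intro: span_base\<close>)
  qed
  then have "(\<lambda>j. F j q) ` {..<k} \<subseteq> span {X q}" by blast
  moreover have "Dperp q = span ((\<lambda>j. F j q) ` {..<k})" using eventually_nhds_x_imp_x[OF F(2)] .
  ultimately have "Dperp q \<subseteq> span {X q}" using span_minimal[OF _ subspace_span] by metis
  moreover have "span {X q} \<subseteq> Dperp q" using span_minimal[OF _ subspace] X_Dperp by simp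
  ultimately show ?thesis by blast
qed

section \<open>The two sides of the equivalence\<close>

lemma X_nonzero: "X q \<noteq> 0"
proof
  assume "X q = 0"
  then have "\<xi> (i q) = 0" using push_scale[of q 0 0] push_X[of q] by simp
  then show False
    using g_xi[OF xi_in_T, of "i q"] eta_xi[of "i q"] g_scale_right[OF xi_in_T xi_in_T, of "i q" 0] by simp
qed

lemma phi_push_Dperp: "v \<in> Dperp q \<Longrightarrow> \<phi> (i q) (push q v) = 0"
proof -
  assume "v \<in> Dperp q"
  then obtain r where "v = r *\<^sub>R X q" unfolding Dperp_eq_span span_singleton by blast
  then show ?thesis by (simp add: push_scale push_X phi_scale xi_in_T phi_xi)
qed

text \<open>With v = r X and w = s X both sides are - r s X, because
  \<open>\<eta>(\<xi>) = -1\<close>.\<close>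

lemma eta_push_swap:
  assumes "v \<in> Dperp q" "w \<in> Dperp q"
  shows "\<eta> (i q) (push q v) *\<^sub>R w = \<eta> (i q) (push q w) *\<^sub>R v"
proof -
  obtain r s where vw: "v = r *\<^sub>R X q" "w = s *\<^sub>R X q"
    using assms unfolding Dperp_eq_span span_singleton by blast
  have "\<eta> (i q) (r *\<^sub>R \<xi> (i q)) = - r" for r
    using g_xi[OF T_closed(3)[OF xi_in_T], of "i q" r] g_xi[OF xi_in_T, of "i q"] eta_xi[of "i q"]
    by (simp add: g_scale_left xi_in_T)
  then show ?thesis by (simp add: vw push_scale push_X mult.commute)
qed

text \<open>The Leibniz rule for the product of the constant 0 with the zero field leaves only
  vanishing terms.\<close>

lemma pullback_zero:
  assumes "pullback_connection B A i nabla nabla_i" "v \<in> tangent_space B q"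
  shows "nabla_i q v (\<lambda>y. 0) = 0"
proof -
  have "smooth_field_along_at B A i q (\<lambda>y. 0)"
    unfolding smooth_field_along_at_def using T_closed(1) B.smooth_at_const by (simp add: zero_fun_def)
  moreover have "\<forall>q f V. \<forall>v\<in>tangent_space B q. smooth_at B q f \<longrightarrow> smooth_field_along_at B A i q V \<longrightarrow>
       nabla_i q v (\<lambda>y. f y *\<^sub>R V y) = v f *\<^sub>R V q + f q *\<^sub>R nabla_i q v V"
    using assms(1)[unfolded pullback_connection_def, THEN conjunct2, THEN conjunct2, THEN conjunct1] .
  ultimately have "nabla_i q v (\<lambda>y. 0 *\<^sub>R 0) = v (\<lambda>y. 0) *\<^sub>R 0 + 0 *\<^sub>R nabla_i q v (\<lambda>y. 0)"
    using assms(2) B.smooth_at_const[of q 0] by blast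
  then show ?thesis by simp
qed

text \<open>Both normal fields are identically zero, so their derivatives vanish in either direction
  and the two definite descriptions have the same defining condition. They agree as terms, without
  an appeal to the uniqueness of the vector described.\<close>

lemma shape_operator_phi_Dperp:
  assumes nabla_i: "pullback_connection B A i nabla nabla_i"
    and Y: "\<And>y. Y y \<in> Dperp y" and Z: "\<And>y. Z y \<in> Dperp y"
  shows "shape_operator B A i g nabla_i (\<lambda>y. \<phi> (i y) (push y (Y y))) q (Z q)
      = shape_operator B A i g nabla_i (\<lambda>y. \<phi> (i y) (push y (Z y))) q (Y q)"
  using pullback_zero[OF nabla_i Dperp_tangent[OF Y]] pullback_zero[OF nabla_i Dperp_tangent[OF Z]]
  by (simp add: shape_operator_def phi_push_Dperp[OF Y] phi_push_Dperp[OF Z])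

lemma integrable_Dperp: "integrable_distribution B Dperp"
  by (rule B.integrable_line_distribution[OF X_field X_nonzero Dperp_eq_span])

end

theorem theorem13:
  fixes A :: "('p::{t2_space,second_countable_topology}, 'n::euclidean_space) chart set"
    and B :: "('q::{t2_space,second_countable_topology}, 'm::euclidean_space) chart set"
    and \<phi> :: "'p \<Rightarrow> 'p tvec \<Rightarrow> 'p tvec"
    and \<xi> :: "'p \<Rightarrow> 'p tvec"
    and \<eta> :: "'p \<Rightarrow> 'p tvec \<Rightarrow> real"
    and g :: "'p \<Rightarrow> 'p tvec \<Rightarrow> 'p tvec \<Rightarrow> real"
    and nabla nabla_bar :: "'p conn"
    and \<alpha> \<beta> :: "'p \<Rightarrow> real"
    and i :: "'q \<Rightarrow> 'p"
    and nabla_i :: "'q \<Rightarrow> 'q tvec \<Rightarrow> ('q \<Rightarrow> 'p tvec) \<Rightarrow> 'p tvec"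
    and D :: "'q \<Rightarrow> 'q tvec set"
  assumes "smooth_atlas A"
    and "LP_Sasakian A \<phi> \<xi> \<eta> g nabla"
    and "generalized_symmetric_metric_connection A \<phi> \<xi> \<eta> g nabla \<alpha> \<beta> nabla_bar"
    and "smooth_atlas B"
    and "CR_submanifold B A i \<phi> \<xi> g D"
    and "xi_vertical B A i \<xi> g D"
    and "pullback_connection B A i nabla nabla_i"
  shows "integrable_distribution B (orth_complement B A i g D) \<longleftrightarrow>
    (\<forall>Y Z. smooth_section B (orth_complement B A i g D) Y \<longrightarrow>
       smooth_section B (orth_complement B A i g D) Z \<longrightarrow>
       (\<forall>q. shape_operator B A i g nabla_i (\<lambda>y. \<phi> (i y) (pushforward A i y (Y y))) q (Z q)
            - shape_operator B A i g nabla_i (\<lambda>y. \<phi> (i y) (pushforward A i y (Z y))) q (Y q)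
          = (\<beta> (i q) - 1) *\<^sub>R
              (\<eta> (i q) (pushforward A i q (Y q)) *\<^sub>R Z q
               - \<eta> (i q) (pushforward A i q (Z q)) *\<^sub>R Y q)))"
proof -
  obtain X where X: "smooth_section B (orth_complement B A i g D) X"
    "\<And>q. pushforward A i q (X q) = \<xi> (i q)"
    using assms(6) unfolding xi_vertical_def by blast
  interpret xi_vertical_CR A \<phi> \<xi> \<eta> g nabla B i D X
    by unfold_locales (use assms X in auto)
  have "shape_operator B A i g nabla_i (\<lambda>y. \<phi> (i y) (push y (Y y))) q (Z q)
      - shape_operator B A i g nabla_i (\<lambda>y. \<phi> (i y) (push y (Z y))) q (Y q)
    = (\<beta> (i q) - 1) *\<^sub>R (\<eta> (i q) (push q (Y q)) *\<^sub>R Z q - \<eta> (i q) (push q (Z q)) *\<^sub>R Y q)"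
    if "smooth_section B Dperp Y" "smooth_section B Dperp Z" for Y Z q
  proof -
    have YZ: "Y y \<in> Dperp y" "Z y \<in> Dperp y" for y using that unfolding smooth_section_def by blast+
    show ?thesis
      unfolding shape_operator_phi_Dperp[OF assms(7) YZ] eta_push_swap[OF YZ] by simp
  qed
  then show ?thesis using integrable_Dperp by simp
qed

end
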